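(* For arbitrary real-time $\mathrm{SC\text{-}OCA}(n)$s, and for arbitrary real-time $\mathrm{MC\text{-}OCA}(\log n)$s, accepting bounded languages, each of the following problems is undecidable: finiteness, infiniteness, universality, inclusion, equivalence, regularity, and context-freedom of the accepted language(s).
   Context: A language $L$ over $\{a_1,\dots,a_k\}$ is bounded if $L\subseteq a_1^*a_2^*\cdots a_k^*$. A CA is $\langle S,F,A,B,\#,b_l,b_r,\delta\rangle$ with communication functions $b_l,b_r:S\to B\cup\{\bot\}$ ($\bot$: nothing sent) and local transition $\delta:(B\cup\{\#,\bot\})\times S\times(B\cup\{\#,\bot\})\to S$; cells $1..|w|$ start with input letters and update synchronously by $c_{t+1}(i)=\delta(b_r(c_t(i-1)),c_t(i),b_l(c_t(i+1)))$, outer cells receiving $\#$ once at the first step. Acceptance: the leftmost cell enters an accepting state; real time: accepted inputs accepted within $|w|$ steps. OCA: $b_r\equiv\bot$, leftmost cell gets no boundary symbol. $\mathrm{com}(i,t)$: number of steps $j<t$ with $b_r(c_j(i))\ne\bot$ or $b_l(c_j(i+1))\ne\bot$; $\mathrm{mcom}(w)=\max_i\mathrm{com}(i,t(|w|))$, $\mathrm{scom}(w)=\sum_{i=1}^{|w|-1}\mathrm{com}(i,t(|w|))$. $\mathrm{SC\text{-}OCA}(n)$: OCAs such that every accepted $w$ is accepted with $\mathrm{scom}(w)\le g(|w|)$ for some $g\in O(n)$; $\mathrm{MC\text{-}OCA}(\log n)$: OCAs such that every accepted $w$ is accepted with $\mathrm{mcom}(w)\le g(|w|)$ for some $g\in O(\log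 n)$. *)

theory Defs
  imports Complex_Main "HOL-Library.Landau_Symbols" "HOL-Library.Nat_Bijection"
begin

datatype recf = Zr | Sc | Id nat | Cn recf "recf list" | Pr recf recf | Mn recf

inductive rec_eval :: "recf \<Rightarrow> nat list \<Rightarrow> nat \<Rightarrow> bool" where
  zero: "rec_eval Zr xs 0"
| succ: "rec_eval Sc [x] (Suc x)"
| proj: "i < length xs \<Longrightarrow> rec_eval (Id i) xs (xs ! i)"
| comp: "length gs = length ys \<Longrightarrow> (\<forall>i<length gs. rec_eval (gs ! i) xs (ys ! i))
          \<Longrightarrow> rec_eval f ys z \<Longrightarrow> rec_eval (Cn f gs) xs z"
| pr0: "rec_eval f xs y \<Longrightarrow> rec_eval (Pr f g) (0 # xs) y"
| prS: "rec_eval (Pr f g) (n # xs) y \<Longrightarrow> rec_eval g (n # y # xs) z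
          \<Longrightarrow> rec_eval (Pr f g) (Suc n # xs) z"
| mu: "rec_eval f (n # xs) 0 \<Longrightarrow> (\<forall>m<n. \<exists>y. rec_eval f (m # xs) (Suc y))
          \<Longrightarrow> rec_eval (Mn f) xs n"

definition undecidable_on :: "'a set \<Rightarrow> ('a \<Rightarrow> bool) \<Rightarrow> ('a \<Rightarrow> nat) \<Rightarrow> bool" where
  "undecidable_on D P code \<longleftrightarrow>
     \<not> (\<exists>r. \<forall>x\<in>D. rec_eval r [code x] (if P x then 1 else 0))"

text \<open>States are 0..<st_num; accepting states acc_list; input alphabet inp_list (ordered
  a_1,...,a_k, subset of the states); messages 0..<msg_num.
  bl_tab ! s = 0 means b_l(s) = bottom, = k+1 means b_l(s) = message k.
  Right-neighbour input codes: 0 = bottom, 1 = #, k+2 = message k.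
  delta_tab ! (s * (msg_num + 2) + r) is delta(bottom, s, r).\<close>
datatype oca = OCA (st_num: nat) (acc_list: "nat list") (inp_list: "nat list")
                   (msg_num: nat) (bl_tab: "nat list") (delta_tab: "nat list")

definition oca_wf :: "oca \<Rightarrow> bool" where
  "oca_wf M \<longleftrightarrow> 0 < st_num M
     \<and> set (acc_list M) \<subseteq> {..<st_num M}
     \<and> inp_list M \<noteq> [] \<and> distinct (inp_list M) \<and> set (inp_list M) \<subseteq> {..<st_num M}
     \<and> length (bl_tab M) = st_num M \<and> (\<forall>b\<in>set (bl_tab M). b \<le> msg_num M)
     \<and> length (delta_tab M) = st_num M * (msg_num M + 2)
     \<and> (\<forall>q\<in>set (delta_tab M). q < st_num M)"

definition oca_delta :: "oca \<Rightarrow> nat \<Rightarrow> nat \<Rightarrow> nat" where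
  "oca_delta M s r = delta_tab M ! (s * (msg_num M + 2) + r)"

text \<open>code of the symbol b_l(s) as an input of delta\<close>
definition bl_in :: "oca \<Rightarrow> nat \<Rightarrow> nat" where
  "bl_in M s = (if bl_tab M ! s = 0 then 0 else Suc (bl_tab M ! s))"

text \<open>Configuration at time t on input w (cell i+1 of the paper is position i).
  The rightmost cell receives # at the first step only; the leftmost cell
  receives nothing (one-way).\<close>
fun conf :: "oca \<Rightarrow> nat list \<Rightarrow> nat \<Rightarrow> nat list" where
  "conf M w 0 = w"
| "conf M w (Suc t) =
     (let c = conf M w t in
      map (\<lambda>i. oca_delta M (c ! i)
                 (if Suc i = length w then (if t = 0 then 1 else 0) else bl_in M (c ! Suc i)))
          [0..<length w])"

definition rt_lang :: "oca \<Rightarrow> nat list set" where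
  "rt_lang M = {w. w \<noteq> [] \<and> set w \<subseteq> set (inp_list M)
      \<and> (\<exists>t. 1 \<le> t \<and> t \<le> length w \<and> hd (conf M w t) \<in> set (acc_list M))}"

text \<open>com(i,t) for the paper's cell i+1 (communication between positions i and i+1);
  in an OCA b_r is identically bottom.\<close>
definition com :: "oca \<Rightarrow> nat list \<Rightarrow> nat \<Rightarrow> nat \<Rightarrow> nat" where
  "com M w i t = card {j. j < t \<and> bl_tab M ! (conf M w j ! Suc i) \<noteq> 0}"

definition scom :: "oca \<Rightarrow> nat list \<Rightarrow> nat" where
  "scom M w = (\<Sum>i<length w - 1. com M w i (length w))"

definition mcom :: "oca \<Rightarrow> nat list \<Rightarrow> nat" where
  "mcom M w = Max ({0} \<union> {com M w i (length w) | i. i < length w - 1})"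

definition SC_OCA_n :: "oca \<Rightarrow> bool" where
  "SC_OCA_n M \<longleftrightarrow> (\<exists>g :: nat \<Rightarrow> real. g \<in> O(\<lambda>n. real n)
      \<and> (\<forall>w\<in>rt_lang M. real (scom M w) \<le> g (length w)))"

definition MC_OCA_log :: "oca \<Rightarrow> bool" where
  "MC_OCA_log M \<longleftrightarrow> (\<exists>g :: nat \<Rightarrow> real. g \<in> O(\<lambda>n. ln (real n))
      \<and> (\<forall>w\<in>rt_lang M. real (mcom M w) \<le> g (length w)))"

definition oca_code :: "oca \<Rightarrow> nat" where
  "oca_code M = list_encode [st_num M, list_encode (acc_list M), list_encode (inp_list M),
                             msg_num M, list_encode (bl_tab M), list_encode (delta_tab M)]"

definition pair_code :: "oca \<times> oca \<Rightarrow> nat" where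
  "pair_code p = prod_encode (oca_code (fst p), oca_code (snd p))"

definition bstar :: "nat list \<Rightarrow> nat list set" where
  "bstar as = {concat (map (\<lambda>(a, n). replicate n a) (zip as ns)) | ns. length ns = length as}"

definition bounded_lang :: "nat list \<Rightarrow> nat list set \<Rightarrow> bool" where
  "bounded_lang as L \<longleftrightarrow> L \<subseteq> bstar as"

definition regular_lang :: "nat list set \<Rightarrow> bool" where
  "regular_lang L \<longleftrightarrow> (\<exists>A Q (q0::nat) F (dl :: nat \<Rightarrow> nat \<Rightarrow> nat).
      finite A \<and> L \<subseteq> lists A \<and> finite Q \<and> q0 \<in> Q \<and> F \<subseteq> Q
      \<and> (\<forall>q\<in>Q. \<forall>a\<in>A. dl q a \<in> Q)
      \<and> (\<forall>w\<in>lists A. w \<in> L \<longleftrightarrow> fold (\<lambda>a q. dl q a) w q0 \<in> F))"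

definition cfg_step :: "(nat \<times> (nat + nat) list) set \<Rightarrow> (nat + nat) list \<Rightarrow> (nat + nat) list \<Rightarrow> bool" where
  "cfg_step P u v \<longleftrightarrow> (\<exists>l r X alpha. (X, alpha) \<in> P \<and> u = l @ [Inr X] @ r \<and> v = l @ alpha @ r)"

definition cfg_lang :: "(nat \<times> (nat + nat) list) set \<Rightarrow> nat \<Rightarrow> nat list set" where
  "cfg_lang P S = {w. (cfg_step P)\<^sup>*\<^sup>* [Inr S] (map Inl w)}"

definition context_free_lang :: "nat list set \<Rightarrow> bool" where
  "context_free_lang L \<longleftrightarrow> (\<exists>P S. finite P \<and> L = cfg_lang P S)"

definition RT_SC_bounded :: "oca set" where
  "RT_SC_bounded = {M. oca_wf M \<and> SC_OCA_n M \<and> bounded_lang (inp_list M) (rt_lang M)}"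

definition RT_MC_bounded :: "oca set" where
  "RT_MC_bounded = {M. oca_wf M \<and> MC_OCA_log M \<and> bounded_lang (inp_list M) (rt_lang M)}"

definition all_problems_undecidable :: "oca set \<Rightarrow> bool" where
  "all_problems_undecidable C \<longleftrightarrow>
      undecidable_on C (\<lambda>M. finite (rt_lang M)) oca_code
    \<and> undecidable_on C (\<lambda>M. infinite (rt_lang M)) oca_code
    \<and> undecidable_on C (\<lambda>M. rt_lang M = bstar (inp_list M) - {[]}) oca_code
    \<and> undecidable_on (C \<times> C) (\<lambda>(M1, M2). rt_lang M1 \<subseteq> rt_lang M2) pair_code
    \<and> undecidable_on (C \<times> C) (\<lambda>(M1, M2). rt_lang M1 = rt_lang M2) pair_code
    \<and> undecidable_on C (\<lambda>M. regular_lang (rt_lang M)) oca_code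
    \<and> undecidable_on C (\<lambda>M. context_free_lang (rt_lang M)) oca_code"

end

theory Submission
  imports Defs "HOL-Computational_Algebra.Primes" "HOL-Library.Infinite_Set"
begin

text \<open>A word \<open>a\<^sup>m b\<^sup>n\<close> is read as a point of the quarter plane: the cell at distance \<open>u\<close> from
  the last \<open>a\<close> is column \<open>u\<close>, and time counts rows. In this plane finitely many rays start at the origin,
  each passing every column once, and a horizontal message bounces off them: it leaves a marked
  column when the steepest ray arrives there and marks the column in which it meets a ray of slope \<open>\<alpha>\<close>. A bounce
  multiplies the marked position by a fixed rational number, a meeting happens only
  if the product is an integer, and the message carries a finite control; hence the marks simulate a
  register machine whose registers are the exponents of primes, with one further prime that makes
  all factors greater than 1. Then every column is crossed once by each ray and by a single bounce, so that
  each cell communicates a constant number of times and the automata lie in both classes.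

  For undecidability no universal machine is needed. The initial position is set by the length of a
  countdown of the \<open>b\<close>-cells, and the code of the automaton is a computable function of the program part and this
  length. A program can therefore compute the code of its own automaton, run an alleged decision procedure
  on it, and halt or diverge so as to refute the answer. After halting the
  marks form a geometric progression, which is neither regular nor context-free; if the program diverges, the
  language is empty. For universality the complement is accepted.\<close>

section \<open>Recursive functions on list codes\<close>

text \<open>If column \<open>u\<close> is given the row \<open>t - u\<close> at time
  \<open>t\<close>, a message that moves one cell per step stays in its row, and a ray of slope
  \<open>s\<close> passes column \<open>u\<close> in row \<open>s * u\<close>. A message launched in
  column \<open>u\<close> by the ray of slope \<open>s\<close> therefore meets the ray of slope
  \<open>r\<close> in column \<open>s * u / r\<close>. Let \<open>P\<close> be the product of the
  register primes. The launching ray has slope \<open>K * P\<close>, the others have slopes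
  \<open>P\<close>, \<open>P / p\<close> and \<open>P * p\<close>; the resulting factors are
  \<open>K\<close>, \<open>K * p\<close> and \<open>K / p\<close>. Since \<open>K\<close> is a prime
  above all register primes, powers of \<open>K\<close> do not disturb divisibility by
  \<open>p\<close>, and a loop tests its register for zero by whether the meeting point
  \<open>K * u / p\<close> is a column. The self-reference needs no fixed-point theorem for
  programs. A number \<open>D\<close> codes all parts of the automaton other than the length of its
  countdown; this length is \<open>P * nth_prime 0 ^ D\<close>, which puts \<open>D\<close> into
  register 0. The program does not depend on \<open>D\<close>, and the code of its automaton is
  \<open>assemble D D\<close>, a computable function of what it finds in register 0.\<close>

definition computable :: "nat \<Rightarrow> (nat list \<Rightarrow> nat) \<Rightarrow> bool" where
  "computable k f \<longleftrightarrow> (\<exists>r. \<forall>xs. length xs = k \<longrightarrow> rec_eval r xs (f xs))"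

lemma computableI: "(\<And>xs. length xs = k \<Longrightarrow> rec_eval r xs (f xs)) \<Longrightarrow> computable k f"
  unfolding computable_def by blast

lemma computable_proj: "i < k \<Longrightarrow> computable k (\<lambda>xs. xs ! i)"
  by (rule computableI[of _ "Id i"]) (auto intro: rec_eval.proj)

lemma computable_proj_drop:
  assumes "n + i < k"
  shows "computable k (\<lambda>xs. drop n xs ! i)"
proof (rule computableI[of _ "Id (n + i)"])
  show "rec_eval (Id (n + i)) xs (drop n xs ! i)" if "length xs = k" for xs
    using rec_eval.proj[of "n + i" xs] that assms by simp
qed

lemma computable_compose:
  assumes "computable (length gs) f" "\<And>g. g \<in> set gs \<Longrightarrow> computable k g"
  shows "computable k (\<lambda>xs. f (map (\<lambda>g. g xs) gs))"
proof -
  obtain rf where rf: "\<And>xs. length xs = length gs \<Longrightarrow> rec_eval rf xs (f xs)"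
    using assms(1) by (auto simp: computable_def)
  obtain R where R: "\<And>g xs. g \<in> set gs \<Longrightarrow> length xs = k \<Longrightarrow> rec_eval (R g) xs (g xs)"
    using assms(2) unfolding computable_def by metis
  show ?thesis
    by (rule computableI[of _ "Cn rf (map R gs)"], rule rec_eval.comp[of _ "map (\<lambda>g. g _) gs"])
       (auto intro: R rf)
qed

lemma computable_compose1:
  "computable 1 (\<lambda>ys. f (ys ! 0)) \<Longrightarrow> computable k g \<Longrightarrow> computable k (\<lambda>xs. f (g xs))"
  using computable_compose[of "[g]" "\<lambda>ys. f (ys ! 0)" k] by simp

lemma computable_compose2:
  "computable 2 (\<lambda>ys. f (ys ! 0) (ys ! 1)) \<Longrightarrow> computable k g \<Longrightarrow> computable k h \<Longrightarrow>
   computable k (\<lambda>xs. f (g xs) (h xs))"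
  using computable_compose[of "[g, h]" "\<lambda>ys. f (ys ! 0) (ys ! 1)" k] by (auto simp: numeral_2_eq_2)

lemma computable_compose3:
  "computable 3 (\<lambda>ys. f (ys ! 0) (ys ! 1) (ys ! 2)) \<Longrightarrow> computable k g \<Longrightarrow> computable k h \<Longrightarrow>
   computable k i \<Longrightarrow> computable k (\<lambda>xs. f (g xs) (h xs) (i xs))"
  using computable_compose[of "[g, h, i]" "\<lambda>ys. f (ys ! 0) (ys ! 1) (ys ! 2)" k]
  by (auto simp: numeral_2_eq_2 numeral_3_eq_3)

lemma computable_Suc: "computable k f \<Longrightarrow> computable k (\<lambda>xs. Suc (f xs))"
proof (erule computable_compose1[rotated], rule computableI[of _ Sc])
  show "rec_eval Sc xs (Suc (xs ! 0))" if "length xs = 1" for xs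
    using that by (cases xs) (auto intro: rec_eval.succ)
qed

lemma computable_const: "computable k (\<lambda>_. c)"
proof (induction c)
  case 0
  show ?case by (rule computableI[of _ Zr]) (auto intro: rec_eval.zero)
qed (rule computable_Suc)

lemma computable_rec_nat:
  assumes "computable k f" "computable (Suc (Suc k)) (\<lambda>zs. g (zs ! 0) (zs ! 1) (drop 2 zs))" "computable k n"
  shows "computable k (\<lambda>xs. rec_nat (f xs) (\<lambda>i y. g i y xs) (n xs))"
proof -
  obtain rf where rf: "\<And>xs. length xs = k \<Longrightarrow> rec_eval rf xs (f xs)"
    using assms(1) by (auto simp: computable_def)
  obtain rg where rg: "\<And>zs. length zs = Suc (Suc k) \<Longrightarrow> rec_eval rg zs (g (zs ! 0) (zs ! 1) (drop 2 zs))"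
    using assms(2) by (auto simp: computable_def)
  have "rec_eval (Pr rf rg) (m # xs) (rec_nat (f xs) (\<lambda>i y. g i y xs) m)" if "length xs = k" for xs m
    using that by (induction m) (auto intro: rec_eval.pr0 rec_eval.prS rf rg[of "_ # _ # xs", simplified])
  hence "computable (Suc k) (\<lambda>zs. rec_nat (f (tl zs)) (\<lambda>i y. g i y (tl zs)) (zs ! 0))"
    by (intro computableI[of _ "Pr rf rg"]) (auto simp: length_Suc_conv)
  \<comment> \<open>\<open>Pr\<close> recurses on the first argument only. Composing with
    \<open>n\<close> and all \<open>k\<close> projections turns this into recursion up to an
    arbitrary computable value with the parameters kept.\<close>
  hence "computable k (\<lambda>xs. (\<lambda>zs. rec_nat (f (tl zs)) (\<lambda>i y. g i y (tl zs)) (zs ! 0))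
      (map (\<lambda>h. h xs) (n # map (\<lambda>i xs. xs ! i) [0..<k])))" (is "computable k ?F")
    using assms(3) by (intro computable_compose) (auto intro: computable_proj)
  moreover have "?F xs = rec_nat (f xs) (\<lambda>i y. g i y xs) (n xs)" if "length xs = k" for xs
    using that map_nth[of xs] by (simp add: comp_def)
  ultimately show ?thesis unfolding computable_def by auto
qed

section \<open>Arithmetic operations\<close>

lemma computable_add2: "computable 2 (\<lambda>xs. xs ! 0 + xs ! 1)"
proof -
  have "computable 2 (\<lambda>xs. rec_nat (xs ! 1) (\<lambda>i y. Suc y) (xs ! 0))"
    by (intro computable_rec_nat computable_Suc computable_proj) auto
  moreover have "rec_nat b (\<lambda>i y. Suc y) a = a + b" for a b :: nat by (induction a) auto
  ultimately show ?thesis by simp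
qed

lemmas computable_add = computable_compose2[OF computable_add2]

lemma computable_mult2: "computable 2 (\<lambda>xs. xs ! 0 * xs ! 1)"
proof -
  have "computable 2 (\<lambda>xs. rec_nat 0 (\<lambda>i y. xs ! 1 + y) (xs ! 0))"
    by (rule computable_rec_nat[where g = "\<lambda>i y xs. xs ! 1 + y"])
      (auto intro!: computable_const computable_add computable_proj computable_proj_drop)
  moreover have "rec_nat 0 (\<lambda>i y. b + y) a = a * b" for a b :: nat by (induction a) auto
  ultimately show ?thesis by simp
qed

lemmas computable_mult = computable_compose2[OF computable_mult2]

lemma computable_power2: "computable 2 (\<lambda>xs. xs ! 0 ^ xs ! 1)"
proof -
  have "computable 2 (\<lambda>xs. rec_nat 1 (\<lambda>i y. xs ! 0 * y) (xs ! 1))"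
    by (rule computable_rec_nat[where g = "\<lambda>i y xs. xs ! 0 * y"])
      (auto intro!: computable_const computable_mult computable_proj computable_proj_drop)
  moreover have "rec_nat 1 (\<lambda>i y. b * y) a = b ^ a" for a b :: nat by (induction a) auto
  ultimately show ?thesis by simp
qed

lemmas computable_power = computable_compose2[OF computable_power2]

lemma computable_pred1: "computable 1 (\<lambda>xs. xs ! 0 - 1)"
proof -
  have "computable 1 (\<lambda>xs. rec_nat 0 (\<lambda>i y. i) (xs ! 0))"
    by (rule computable_rec_nat[where g = "\<lambda>i y xs. i"]) (auto intro!: computable_const computable_proj)
  moreover have "rec_nat 0 (\<lambda>i y. i) a = a - 1" for a :: nat by (cases a) auto
  ultimately show ?thesis by simp
qed

lemma computable_diff2: "computable 2 (\<lambda>xs. xs ! 0 - xs ! 1)"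
proof -
  have "computable 2 (\<lambda>xs. rec_nat (xs ! 0) (\<lambda>i y. y - 1) (xs ! 1))"
    by (intro computable_rec_nat[where g = "\<lambda>i y xs. y - 1"] computable_proj
        computable_compose1[OF computable_pred1]) auto
  moreover have "rec_nat b (\<lambda>i y. y - 1) a = b - a" for a b :: nat by (induction a) auto
  ultimately show ?thesis by simp
qed

lemmas computable_diff = computable_compose2[OF computable_diff2]

section \<open>The pairing function and its inverses\<close>

lemma computable_triangle1: "computable 1 (\<lambda>xs. triangle (xs ! 0))"
proof -
  have "computable 1 (\<lambda>xs. rec_nat 0 (\<lambda>i y. y + Suc i) (xs ! 0))"
    by (rule computable_rec_nat[where g = "\<lambda>i y xs. y + Suc i"])
      (auto intro!: computable_const computable_proj computable_add computable_Suc)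
  moreover have "rec_nat 0 (\<lambda>i y. y + Suc i) a = triangle a" for a :: nat by (induction a) auto
  ultimately show ?thesis by simp
qed

lemmas computable_triangle = computable_compose1[OF computable_triangle1]

lemma computable_prod_encode:
  "computable k f \<Longrightarrow> computable k g \<Longrightarrow> computable k (\<lambda>xs. prod_encode (f xs, g xs))"
  unfolding prod_encode_def by (auto intro!: computable_add computable_triangle)

text \<open>The truncated differences add 1 exactly when \<open>Suc i\<close> has reached the next
  triangular number, so primitive recursion finds the largest \<open>y\<close> with
  \<open>triangle y \<le> n\<close>.\<close>

definition triangle_root :: "nat \<Rightarrow> nat" where
  "triangle_root n = rec_nat 0 (\<lambda>i y. y + (1 - (triangle (Suc y) - Suc i))) n"

lemma triangle_root_bounds: "triangle (triangle_root n) \<le> n \<and> n < triangle (Suc (triangle_root n))"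
proof (induction n)
  case (Suc n)
  let ?t = "triangle_root n"
  have "triangle_root (Suc n) = (if triangle (Suc ?t) \<le> Suc n then Suc ?t else ?t)"
    by (auto simp: triangle_root_def)
  thus ?case using Suc by (auto split: if_splits)
qed (simp add: triangle_root_def)

lemma triangle_mono: "a \<le> b \<Longrightarrow> triangle a \<le> triangle b"
  by (induction rule: dec_induct) auto

lemma triangle_root_eq:
  assumes "j \<le> s"
  shows "triangle_root (triangle s + j) = s"
proof -
  let ?t = "triangle_root (triangle s + j)"
  have "\<not> Suc ?t \<le> s" "\<not> Suc s \<le> ?t"
    using triangle_root_bounds[of "triangle s + j"] triangle_mono[of "Suc ?t" s]
      triangle_mono[of "Suc s" ?t] assms by auto
  thus ?thesis by simp
qed

text \<open>\<open>prod_encode (a, b)\<close> is \<open>triangle (a + b) + a\<close>: the root is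
  \<open>a + b\<close>, the excess over its triangular number is \<open>a\<close>.\<close>

definition code_fst :: "nat \<Rightarrow> nat" where "code_fst z = z - triangle (triangle_root z)"
definition code_snd :: "nat \<Rightarrow> nat" where "code_snd z = triangle_root z - code_fst z"

lemma code_fst_encode [simp]: "code_fst (prod_encode (a, b)) = a"
  by (simp add: code_fst_def prod_encode_def triangle_root_eq)

lemma code_snd_encode [simp]: "code_snd (prod_encode (a, b)) = b"
  unfolding code_snd_def code_fst_encode by (simp add: prod_encode_def triangle_root_eq)

lemma computable_triangle_root1: "computable 1 (\<lambda>xs. triangle_root (xs ! 0))"
  unfolding triangle_root_def
  by (rule computable_rec_nat[where g = "\<lambda>i y xs. y + (1 - (triangle (Suc y) - Suc i))"])
    (auto intro!: computable_const computable_proj computable_add computable_diff computable_triangle computable_Suc)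

lemmas computable_triangle_root = computable_compose1[OF computable_triangle_root1]

lemma computable_code_fst: "computable k f \<Longrightarrow> computable k (\<lambda>xs. code_fst (f xs))"
  unfolding code_fst_def by (auto intro!: computable_diff computable_triangle computable_triangle_root)

lemma computable_code_snd: "computable k f \<Longrightarrow> computable k (\<lambda>xs. code_snd (f xs))"
  unfolding code_snd_def by (auto intro!: computable_diff computable_code_fst computable_triangle_root)

section \<open>Operations on list codes\<close>

definition code_cons :: "nat \<Rightarrow> nat \<Rightarrow> nat" where "code_cons x l = Suc (prod_encode (x, l))"

lemma code_cons_encode: "code_cons x (list_encode l) = list_encode (x # l)"
  by (simp add: code_cons_def)

lemma computable_code_cons:
  "computable k f \<Longrightarrow> computable k g \<Longrightarrow> computable k (\<lambda>xs. code_cons (f xs) (g xs))"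
  unfolding code_cons_def by (auto intro!: computable_Suc computable_prod_encode)

text \<open>The state is the pair of the remaining reversed prefix and the accumulated list. A list is not
  longer than its code, so \<^term>\<open>l\<close> iterations exhaust the prefix; the surplus iterations see the
  code 0 of the empty list and must change nothing.\<close>
definition code_rev_append_step :: "nat \<Rightarrow> nat" where
  "code_rev_append_step z = (if code_fst z = 0 then z
     else prod_encode (code_snd (code_fst z - 1), code_cons (code_fst (code_fst z - 1)) (code_snd z)))"

definition code_rev_append :: "nat \<Rightarrow> nat \<Rightarrow> nat" where
  "code_rev_append l acc = code_snd (rec_nat (prod_encode (l, acc)) (\<lambda>i. code_rev_append_step) l)"

lemma length_le_list_encode: "length xs \<le> list_encode xs"
proof (induction xs)
  case (Cons x xs)
  have "list_encode xs \<le> prod_encode (x, list_encode xs)" by (rule le_prod_encode_2)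
  with Cons show ?case by simp
qed simp

lemma code_rev_append_encode: "code_rev_append (list_encode xs) (list_encode ys) = list_encode (rev xs @ ys)"
proof -
  have "rec_nat (prod_encode (list_encode xs, list_encode ys)) (\<lambda>i. code_rev_append_step) n =
     prod_encode (list_encode (drop n xs), list_encode (rev (take n xs) @ ys))" for n
  proof (induction n)
    case (Suc n)
    show ?case
    proof (cases "n < length xs")
      case True
      hence "drop n xs = xs ! n # drop (Suc n) xs" "take (Suc n) xs = take n xs @ [xs ! n]"
        by (simp_all add: Cons_nth_drop_Suc take_Suc_conv_app_nth)
      thus ?thesis using Suc by (simp add: code_rev_append_step_def code_cons_def)
    next
      case False
      thus ?thesis using Suc by (simp add: code_rev_append_step_def)
    qed
  qed simp
  from this[of "list_encode xs"] show ?thesis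
    using length_le_list_encode[of xs] by (simp add: code_rev_append_def)
qed

lemma computable_if_zero:
  assumes "computable k c" "computable k f" "computable k g"
  shows "computable k (\<lambda>xs. if c xs = 0 then f xs else g xs)"
proof -
  have "(if c xs = 0 then f xs else g xs) = (1 - c xs) * f xs + (1 - (1 - c xs)) * g xs" for xs
    by auto
  thus ?thesis using assms by (auto intro!: computable_add computable_mult computable_diff computable_const)
qed

lemma computable_code_rev_append:
  assumes "computable k f" "computable k g"
  shows "computable k (\<lambda>xs. code_rev_append (f xs) (g xs))"
proof -
  have step: "computable (Suc (Suc k)) (\<lambda>zs. code_rev_append_step (zs ! 1))" for k
    unfolding code_rev_append_step_def
    by (intro computable_if_zero computable_prod_encode computable_code_fst computable_code_snd
        computable_code_cons computable_diff computable_const computable_proj) auto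
  have "computable 2 (\<lambda>xs. code_rev_append (xs ! 0) (xs ! 1))"
    unfolding code_rev_append_def
    by (intro computable_code_snd computable_rec_nat[where g = "\<lambda>i y xs. code_rev_append_step y"]
        step computable_prod_encode computable_proj) auto
  from computable_compose2[OF this assms] show ?thesis .
qed

definition code_replicate :: "nat \<Rightarrow> nat \<Rightarrow> nat" where
  "code_replicate c n = rec_nat 0 (\<lambda>i. code_cons c) n"

lemma code_replicate_encode: "code_replicate c n = list_encode (replicate n c)"
  by (induction n) (auto simp: code_replicate_def code_cons_def)

lemma computable_code_replicate:
  assumes "computable k f" "computable k g"
  shows "computable k (\<lambda>xs. code_replicate (f xs) (g xs))"
proof -
  have "computable 2 (\<lambda>xs. code_replicate (xs ! 0) (xs ! 1))"
    unfolding code_replicate_def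
    by (rule computable_rec_nat[where g = "\<lambda>i y xs. code_cons (xs ! 0) y"])
      (auto intro!: computable_const computable_code_cons computable_proj computable_proj_drop)
  from computable_compose2[OF this assms] show ?thesis .
qed

text \<open>The rows of the states \<^term>\<open>s\<close>, \dots, \<^term>\<open>s + d - 1\<close> of a transition table in which a state
  leads to its predecessor without an input and behaves like \<^term>\<open>rest\<close> otherwise.\<close>
definition countdown_rows :: "nat list \<Rightarrow> nat \<Rightarrow> nat \<Rightarrow> nat list" where
  "countdown_rows rest s d = concat (map (\<lambda>i. (i - 1) # rest) [s..<s + d])"

text \<open>Lists grow at the front, so the rows are produced from the last state downwards. The
  code \<open>rest\<close> is that of the reversed list, since \<open>code_rev_append\<close>
  reverses it back.\<close>

definition code_countdown_rows :: "nat \<Rightarrow> nat \<Rightarrow> nat \<Rightarrow> nat" where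
  "code_countdown_rows rest s d =
     rec_nat 0 (\<lambda>i l. code_cons (s + d - Suc i - 1) (code_rev_append rest l)) d"

lemma code_countdown_rows_encode:
  "code_countdown_rows (list_encode (rev rest)) s d = list_encode (countdown_rows rest s d)"
proof -
  have "rec_nat 0 (\<lambda>i l. code_cons (s + d - Suc i - 1) (code_rev_append (list_encode (rev rest)) l)) n
      = list_encode (countdown_rows rest (s + d - n) n)" if "n \<le> d" for n
    using that
  proof (induction n)
    case (Suc n)
    have "[s + d - Suc n..<s + d] = (s + d - Suc n) # [s + d - n..<s + d]"
      using Suc.prems by (subst upt_conv_Cons) (auto simp: Suc_diff_Suc)
    hence "countdown_rows rest (s + d - Suc n) (Suc n)
        = (s + d - Suc n - 1) # rest @ countdown_rows rest (s + d - n) n"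
      using Suc.prems by (simp add: countdown_rows_def)
    thus ?case using Suc by (simp add: code_rev_append_encode code_cons_def)
  qed (simp add: countdown_rows_def)
  from this[of d] show ?thesis by (simp add: code_countdown_rows_def)
qed

lemma computable_code_countdown_rows:
  assumes "computable k f" "computable k g" "computable k h"
  shows "computable k (\<lambda>xs. code_countdown_rows (f xs) (g xs) (h xs))"
proof -
  have "computable 3 (\<lambda>xs. code_countdown_rows (xs ! 0) (xs ! 1) (xs ! 2))"
    unfolding code_countdown_rows_def
    by (rule computable_rec_nat[where g = "\<lambda>i l xs. code_cons (xs ! 1 + xs ! 2 - Suc i - 1) (code_rev_append (xs ! 0) l)"])
      (auto intro!: computable_const computable_code_cons computable_proj computable_proj_drop computable_code_rev_append
        computable_diff computable_add computable_Suc)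
  from computable_compose3[OF this assms] show ?thesis .
qed

section \<open>Register programs for recursive functions\<close>

datatype cmd = Skip | Inc nat | Seq cmd cmd | Loop nat cmd

type_synonym config = "cmd list \<times> (nat \<Rightarrow> nat)"

fun step :: "config \<Rightarrow> config" where
  "step ([], R) = ([], R)"
| "step (Skip # k, R) = (k, R)"
| "step (Inc i # k, R) = (k, R(i := Suc (R i)))"
| "step (Seq a b # k, R) = (a # b # k, R)"
| "step (Loop i c # k, R) = (if R i = 0 then (k, R) else (c # Loop i c # k, R(i := R i - 1)))"

text \<open>Quantifying over the continuation \<open>k\<close> makes the relation compositional: a
  subprogram runs the same way in front of whatever remains to be done.\<close>

definition runs :: "cmd \<Rightarrow> (nat \<Rightarrow> nat) \<Rightarrow> (nat \<Rightarrow> nat) \<Rightarrow> bool" where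
  "runs c R R' \<longleftrightarrow> (\<forall>k. \<exists>n. (step ^^ n) (c # k, R) = (k, R'))"

lemma runs_by_step:
  assumes "\<And>k. \<exists>n. (step ^^ n) (step (c # k, R)) = (k, R')"
  shows "runs c R R'"
  unfolding runs_def
proof
  fix k
  obtain n where "(step ^^ n) (step (c # k, R)) = (k, R')" using assms by blast
  hence "(step ^^ Suc n) (c # k, R) = (k, R')" by (simp only: funpow_Suc_right comp_apply)
  thus "\<exists>n. (step ^^ n) (c # k, R) = (k, R')" by blast
qed

lemma runs_Skip: "runs Skip R R"
  by (rule runs_by_step) (auto intro: exI[of _ 0])

lemma runs_Inc: "runs (Inc i) R (R(i := Suc (R i)))"
  by (rule runs_by_step) (auto intro: exI[of _ 0])

lemma steps_trans:
  assumes "\<exists>n. (step ^^ n) x = y" "\<exists>n. (step ^^ n) y = z"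
  shows "\<exists>n. (step ^^ n) x = z"
proof -
  obtain m n where "(step ^^ m) x = y" "(step ^^ n) y = z" using assms by blast
  hence "(step ^^ (n + m)) x = z" by (simp add: funpow_add)
  thus ?thesis by blast
qed

lemma runs_Seq: "runs a R R1 \<Longrightarrow> runs b R1 R2 \<Longrightarrow> runs (Seq a b) R R2"
  by (rule runs_by_step, simp only: step.simps, unfold runs_def) (blast intro: steps_trans)

lemma runs_Loop_0: "R i = 0 \<Longrightarrow> runs (Loop i c) R R"
  by (rule runs_by_step) (auto intro: exI[of _ 0])

lemma runs_Loop_Suc:
  "R i = Suc m \<Longrightarrow> runs c (R(i := m)) R1 \<Longrightarrow> runs (Loop i c) R1 R2 \<Longrightarrow> runs (Loop i c) R R2"
  by (rule runs_by_step, simp, unfold runs_def) (blast intro: steps_trans)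

lemma runs_eq: "runs c R R1 \<Longrightarrow> R1 = R2 \<Longrightarrow> runs c R R2"
  by simp

definition clear :: "nat \<Rightarrow> cmd" where "clear i = Loop i Skip"
definition move :: "nat \<Rightarrow> nat \<Rightarrow> cmd" where "move i j = Loop i (Inc j)"
text \<open>A loop destroys its counter, so the value goes to \<open>j\<close> and \<open>t\<close>
  at once and is then moved back from \<open>t\<close>.\<close>

definition copy :: "nat \<Rightarrow> nat \<Rightarrow> nat \<Rightarrow> cmd" where
  "copy i j t = Seq (Loop i (Seq (Inc j) (Inc t))) (move t i)"

lemma runs_clear: "runs (clear i) R (R(i := 0))"
proof (induction "R i" arbitrary: R)
  case 0
  thus ?case unfolding clear_def by (metis fun_upd_triv runs_Loop_0)
next
  case (Suc m)
  show ?case unfolding clear_def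
  proof (rule runs_Loop_Suc[where R = R and i = i, OF Suc(2)[symmetric] runs_Skip])
    show "runs (Loop i Skip) (R(i := m)) (R(i := 0))"
      using Suc(1)[of "R(i := m)"] by (simp add: clear_def)
  qed
qed

lemma runs_move: "i \<noteq> j \<Longrightarrow> runs (move i j) R (R(i := 0, j := R j + R i))"
proof (induction "R i" arbitrary: R)
  case 0
  hence "R(i := 0, j := R j + R i) = R" by auto
  thus ?case unfolding move_def using 0 runs_Loop_0 by metis
next
  case (Suc m)
  show ?case unfolding move_def
  proof (rule runs_Loop_Suc[where R = R and i = i, OF Suc(2)[symmetric] runs_Inc])
    let ?R = "(R(i := m))(j := Suc ((R(i := m)) j))"
    show "runs (Loop i (Inc j)) ?R (R(i := 0, j := R j + R i))"
      by (rule runs_eq[OF Suc(1)[of ?R, unfolded move_def]]) (use Suc in auto)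
  qed
qed

lemma runs_copy:
  assumes "i \<noteq> j" "i \<noteq> t" "j \<noteq> t" "R t = 0"
  shows "runs (copy i j t) R (R(j := R j + R i))"
proof -
  have "runs (Loop i (Seq (Inc j) (Inc t))) R (R(i := 0, j := R j + R i, t := R t + R i))" for R
  proof (induction "R i" arbitrary: R)
    case 0
    hence "R(i := 0, j := R j + R i, t := R t + R i) = R" by auto
    thus ?case using 0 runs_Loop_0 by metis
  next
    case (Suc m)
    show ?case
    proof (rule runs_Loop_Suc[where R = R and i = i, OF Suc(2)[symmetric] runs_Seq[OF runs_Inc runs_Inc]])
      let ?S = "(R(i := m))(j := Suc ((R(i := m)) j))"
      let ?R = "?S(t := Suc (?S t))"
      show "runs (Loop i (Seq (Inc j) (Inc t))) ?R (R(i := 0, j := R j + R i, t := R t + R i))"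
        by (rule runs_eq[OF Suc(1)[of ?R]]) (use Suc assms in auto)
    qed
  qed
  from runs_Seq[OF this runs_move] show ?thesis
    unfolding copy_def by (rule runs_eq) (use assms in auto)
qed

fun copies :: "nat \<Rightarrow> nat \<Rightarrow> nat \<Rightarrow> nat \<Rightarrow> cmd" where
  "copies b d t 0 = Skip"
| "copies b d t (Suc n) = Seq (copies b d t n) (copy (b + n) (d + n) t)"

lemma runs_copies:
  assumes "b + n \<le> d" "d + n \<le> t" "R t = 0" "\<forall>i<n. R (d + i) = 0"
  shows "runs (copies b d t n) R (\<lambda>r. if d \<le> r \<and> r < d + n then R (b + (r - d)) else R r)"
  using assms
proof (induction n)
  case 0
  show ?case unfolding copies.simps by (rule runs_eq[OF runs_Skip]) auto
next
  case (Suc n)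
  let ?R = "\<lambda>r. if d \<le> r \<and> r < d + n then R (b + (r - d)) else R r"
  have "runs (copies b d t n) R ?R" by (rule Suc.IH) (use Suc.prems in auto)
  moreover have "runs (copy (b + n) (d + n) t) ?R (?R(d + n := ?R (d + n) + ?R (b + n)))"
    by (rule runs_copy) (use Suc.prems in auto)
  ultimately show ?case
    unfolding copies.simps by (rule runs_eq[OF runs_Seq]) (use Suc.prems in \<open>auto simp: less_Suc_eq\<close>)
qed

fun clears :: "nat \<Rightarrow> nat \<Rightarrow> cmd" where
  "clears d 0 = Skip"
| "clears d (Suc n) = Seq (clears d n) (clear (d + n))"

lemma runs_clears: "runs (clears d n) R (\<lambda>r. if d \<le> r \<and> r < d + n then 0 else R r)"
proof (induction n)
  case 0
  show ?case unfolding clears.simps by (rule runs_eq[OF runs_Skip]) auto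
next
  case (Suc n)
  show ?case unfolding clears.simps
    by (rule runs_eq[OF runs_Seq[OF Suc runs_clear]]) (auto simp: less_Suc_eq)
qed

text \<open>Everything except \<open>out\<close> is restored, so the scratch registers from
  \<open>s\<close> on can be shared by successive subprograms. Nothing is claimed where
  \<open>r\<close> has no value; the diagonal program only has to react to values that
  exist.\<close>

definition implements :: "recf \<Rightarrow> nat \<Rightarrow> cmd \<Rightarrow> nat \<Rightarrow> nat \<Rightarrow> nat \<Rightarrow> bool" where
  "implements r n c b out s \<longleftrightarrow> (\<forall>xs y R. length xs = n \<longrightarrow> rec_eval r xs y \<longrightarrow> (\<forall>i<n. R (b + i) = xs ! i) \<longrightarrow>
     R out = 0 \<longrightarrow> (\<forall>j\<ge>s. R j = 0) \<longrightarrow> runs c R (R(out := y)))"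

lemma implementsI:
  "(\<And>xs y R. length xs = n \<Longrightarrow> rec_eval r xs y \<Longrightarrow> \<forall>i<n. R (b + i) = xs ! i \<Longrightarrow>
     R out = 0 \<Longrightarrow> \<forall>j\<ge>s. R j = 0 \<Longrightarrow> runs c R (R(out := y))) \<Longrightarrow> implements r n c b out s"
  unfolding implements_def by blast

lemma implementsD:
  "implements r n c b out s \<Longrightarrow> rec_eval r xs y \<Longrightarrow> length xs = n \<Longrightarrow> (\<And>i. i < n \<Longrightarrow> R (b + i) = xs ! i) \<Longrightarrow>
     R out = 0 \<Longrightarrow> (\<And>j. s \<le> j \<Longrightarrow> R j = 0) \<Longrightarrow> runs c R (R(out := y))"
  unfolding implements_def by blast

inductive_cases rec_eval_ZrE: "rec_eval Zr xs y"
inductive_cases rec_eval_ScE: "rec_eval Sc xs y"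
inductive_cases rec_eval_IdE: "rec_eval (Id i) xs y"
inductive_cases rec_eval_CnE: "rec_eval (Cn f gs) xs y"
inductive_cases rec_eval_Pr_NilE: "rec_eval (Pr f g) [] y"
inductive_cases rec_eval_Pr0E: "rec_eval (Pr f g) (0 # xs) y"
inductive_cases rec_eval_PrSE: "rec_eval (Pr f g) (Suc n # xs) y"
inductive_cases rec_eval_MnE: "rec_eval (Mn f) xs y"

text \<open>\<open>Y\<close> names all intermediate values of the recursion at once, for use in a
  loop invariant.\<close>

lemma rec_eval_Pr_values:
  "rec_eval (Pr f g) (N # xs) y \<Longrightarrow>
   \<exists>Y. Y N = y \<and> rec_eval f xs (Y 0) \<and> (\<forall>i<N. rec_eval g (i # Y i # xs) (Y (Suc i)))"
proof (induction N arbitrary: y)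
  case 0
  thus ?case by (auto elim!: rec_eval_Pr0E)
next
  case (Suc N)
  then obtain v where v: "rec_eval (Pr f g) (N # xs) v" "rec_eval g (N # v # xs) y"
    by (auto elim: rec_eval_PrSE)
  then obtain Y where "Y N = v" "rec_eval f xs (Y 0)" "\<forall>i<N. rec_eval g (i # Y i # xs) (Y (Suc i))"
    using Suc.IH by blast
  thus ?case using v(2) by (intro exI[of _ "Y(Suc N := y)"]) (auto simp: less_Suc_eq)
qed

lemma implements_Cn:
  assumes gs: "\<And>g b out s. g \<in> set gs \<Longrightarrow> b + n \<le> s \<Longrightarrow> out < s \<Longrightarrow> out \<notin> {b..<b + n} \<Longrightarrow> \<exists>c. implements g n c b out s"
    and f: "\<And>b out s. b + length gs \<le> s \<Longrightarrow> out < s \<Longrightarrow> out \<notin> {b..<b + length gs} \<Longrightarrow> \<exists>c. implements f (length gs) c b out s"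
    and b: "b + n \<le> s" "out < s" "out \<notin> {b..<b + n}"
  shows "\<exists>c. implements (Cn f gs) n c b out s"
proof -
  let ?k = "length gs"
  \<comment> \<open>The results of \<open>gs\<close> are collected in the registers from
    \<open>s\<close> on and later form the argument block of \<open>f\<close>. The scratch space of
    each component starts at \<open>s + length gs\<close>, beyond all results.\<close>
  have "\<exists>c. \<forall>xs ys R. length xs = n \<longrightarrow> length ys = ?k \<longrightarrow> (\<forall>i<?k. rec_eval (gs ! i) xs (ys ! i)) \<longrightarrow>
     (\<forall>i<n. R (b + i) = xs ! i) \<longrightarrow> (\<forall>j\<ge>s. R j = 0) \<longrightarrow>
     runs c R (\<lambda>r. if s \<le> r \<and> r < s + m then ys ! (r - s) else R r)" if "m \<le> ?k" for m
    using that
  proof (induction m)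
    case 0
    show ?case by (rule exI[of _ Skip]) (auto intro!: runs_eq[OF runs_Skip])
  next
    case (Suc m)
    hence "m \<le> ?k" by simp
    from Suc.IH[OF this] obtain c where c: "\<And>xs ys R. length xs = n \<Longrightarrow> length ys = ?k \<Longrightarrow> \<forall>i<?k. rec_eval (gs ! i) xs (ys ! i) \<Longrightarrow>
     \<forall>i<n. R (b + i) = xs ! i \<Longrightarrow> \<forall>j\<ge>s. R j = 0 \<Longrightarrow>
     runs c R (\<lambda>r. if s \<le> r \<and> r < s + m then ys ! (r - s) else R r)" by blast
    obtain cg where cg: "implements (gs ! m) n cg b (s + m) (s + ?k)"
      using gs[of "gs ! m" b "s + ?k" "s + m"] Suc.prems b by auto
    show ?case
    proof (intro exI[of _ "Seq c cg"] allI impI)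
      fix xs ys and R :: "nat \<Rightarrow> nat"
      assume H: "length xs = n" "length ys = ?k" "\<forall>i<?k. rec_eval (gs ! i) xs (ys ! i)"
        "\<forall>i<n. R (b + i) = xs ! i" "\<forall>j\<ge>s. R j = 0"
      let ?R = "\<lambda>r. if s \<le> r \<and> r < s + m then ys ! (r - s) else R r"
      have "runs cg ?R (?R(s + m := ys ! m))"
        by (rule implementsD[OF cg, of xs]) (use H Suc.prems b in auto)
      thus "runs (Seq c cg) R (\<lambda>r. if s \<le> r \<and> r < s + Suc m then ys ! (r - s) else R r)"
        by (rule runs_eq[OF runs_Seq[OF c[OF H]]]) (auto simp: less_Suc_eq)
    qed
  qed
  then obtain c where c: "\<And>xs ys R. length xs = n \<Longrightarrow> length ys = ?k \<Longrightarrow> \<forall>i<?k. rec_eval (gs ! i) xs (ys ! i) \<Longrightarrow>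
     \<forall>i<n. R (b + i) = xs ! i \<Longrightarrow> \<forall>j\<ge>s. R j = 0 \<Longrightarrow>
     runs c R (\<lambda>r. if s \<le> r \<and> r < s + ?k then ys ! (r - s) else R r)" by blast
  obtain cf where cf: "implements f ?k cf s out (s + ?k)" using f[of s "s + ?k" out] b by auto
  have "implements (Cn f gs) n (Seq c (Seq cf (clears s ?k))) b out s"
  proof (rule implementsI)
    fix xs y and R :: "nat \<Rightarrow> nat"
    assume H: "length xs = n" "rec_eval (Cn f gs) xs y" "\<forall>i<n. R (b + i) = xs ! i" "R out = 0" "\<forall>j\<ge>s. R j = 0"
    from H(2) obtain ys where ys: "length ys = ?k" "\<forall>i<?k. rec_eval (gs ! i) xs (ys ! i)" "rec_eval f ys y"
      by (auto elim: rec_eval_CnE)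
    let ?R = "\<lambda>r. if s \<le> r \<and> r < s + ?k then ys ! (r - s) else R r"
    have "runs cf ?R (?R(out := y))"
      by (rule implementsD[OF cf ys(3,1)]) (use H b in auto)
    from runs_Seq[OF c[OF H(1) ys(1,2) H(3,5)] runs_Seq[OF this runs_clears]]
    show "runs (Seq c (Seq cf (clears s ?k))) R (R(out := y))"
      by (rule runs_eq) (use H b in auto)
  qed
  thus ?thesis by blast
qed

lemma implements_Pr:
  assumes f: "\<And>n b out s. b + n \<le> s \<Longrightarrow> out < s \<Longrightarrow> out \<notin> {b..<b + n} \<Longrightarrow> \<exists>c. implements f n c b out s"
    and g: "\<And>n b out s. b + n \<le> s \<Longrightarrow> out < s \<Longrightarrow> out \<notin> {b..<b + n} \<Longrightarrow> \<exists>c. implements g n c b out s"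
    and b: "b + n \<le> s" "out < s" "out \<notin> {b..<b + n}"
  shows "\<exists>c. implements (Pr f g) n c b out s"
proof (cases n)
  case 0
  \<comment> \<open>\<open>Pr\<close> has no value on the empty argument list, so any program will
    do.\<close>
  have "implements (Pr f g) n Skip b out s"
    by (rule implementsI) (use 0 in \<open>auto elim: rec_eval_Pr_NilE\<close>)
  thus ?thesis by blast
next
  case (Suc m)
  \<comment> \<open>The registers from \<open>s\<close> on hold the round number, the current value
    and the parameters, which is exactly the argument list of \<open>g\<close>. Register
    \<open>z\<close> receives the next value, \<open>cnt\<close> counts the remaining rounds, and
    \<open>t\<close> starts the scratch space.\<close>
  define z cnt t where "z = s + 2 + m" and "cnt = s + 3 + m" and "t = s + 4 + m"
  obtain cf where cf: "implements f m cf (b + 1) (s + 1) t"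
    using f[of "b + 1" m t "s + 1"] b Suc by (auto simp: t_def)
  obtain cg where cg: "implements g (m + 2) cg s z t"
    using g[of s "m + 2" t z] by (auto simp: t_def z_def)
  define body where "body = Seq cg (Seq (clear (s + 1)) (Seq (move z (s + 1)) (Inc s)))"
  have "implements (Pr f g) n (Seq (copies (b + 1) (s + 2) t m) (Seq (copy b cnt t) (Seq cf
    (Seq (Loop cnt body) (Seq (move (s + 1) out) (Seq (clear s) (clears (s + 2) m))))))) b out s"
  proof (rule implementsI)
    fix xs y and R :: "nat \<Rightarrow> nat"
    assume H: "length xs = n" "rec_eval (Pr f g) xs y" "\<forall>i<n. R (b + i) = xs ! i" "R out = 0" "\<forall>j\<ge>s. R j = 0"
    from H(1) Suc obtain N xs' where xs: "xs = N # xs'" "length xs' = m" by (auto simp: length_Suc_conv)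
    from rec_eval_Pr_values[OF H(2)[unfolded xs(1)]] obtain Y where
      Y: "Y N = y" "rec_eval f xs' (Y 0)" "\<forall>i<N. rec_eval g (i # Y i # xs') (Y (Suc i))" by blast
    have Rb: "R b = N" "\<And>i. i < m \<Longrightarrow> R (Suc (b + i)) = xs' ! i"
      using H(3)[rule_format, of 0] H(3)[rule_format, of "Suc _"] xs Suc by auto
    define S where "S i v c r = (if r = s then i else if r = s + 1 then v
      else if s + 2 \<le> r \<and> r < s + 2 + m then xs' ! (r - (s + 2)) else if r = cnt then c else R r)" for i v c r
    have R0: "\<And>r. s \<le> r \<Longrightarrow> R r = 0" using H(5) by blast
    have Rx: "R (Suc (b + r - d)) = xs' ! (r - d)" if "d \<le> r" "r < d + m" for r d
      using Rb(2)[of "r - d"] that by (simp add: less_diff_conv2 add.commute)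
    have 1: "runs (copies (b + 1) (s + 2) t m) R (S 0 0 0)"
      by (rule runs_eq[OF runs_copies]) (use R0 Rb Rx b Suc in \<open>auto simp: t_def S_def cnt_def fun_eq_iff\<close>)
    have "S 0 0 0 t = 0" using R0 by (auto simp: S_def t_def cnt_def)
    hence 2: "runs (copy b cnt t) (S 0 0 0) (S 0 0 N)"
      by (intro runs_eq[OF runs_copy]) (use Rb b Suc in \<open>auto simp: t_def S_def cnt_def\<close>)
    have "runs cf (S 0 0 N) ((S 0 0 N)(s + 1 := Y 0))"
      by (rule implementsD[OF cf Y(2) xs(2)]) (use Rb R0 b Suc in \<open>auto simp: S_def cnt_def t_def\<close>)
    hence 3: "runs cf (S 0 0 N) (S 0 (Y 0) N)"
      by (rule runs_eq) (auto simp: S_def)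
    have "runs (Loop cnt body) (S (N - c) (Y (N - c)) c) (S N (Y N) 0)" if "c \<le> N" for c
      using that
    proof (induction c)
      case 0
      show ?case by (rule runs_eq[OF runs_Loop_0]) (auto simp: S_def cnt_def)
    next
      case (Suc c)
      define i where "i = N - Suc c"
      have i: "i < N" "N - c = Suc i" using Suc.prems by (auto simp: i_def)
      have "runs cg (S i (Y i) c) ((S i (Y i) c)(z := Y (Suc i)))"
      proof (rule implementsD[OF cg])
        show "S i (Y i) c (s + j) = (i # Y i # xs') ! j" if "j < m + 2" for j
          using that by (cases j rule: nat.exhaust; cases "j - 1") (auto simp: S_def)
      qed (use i Y(3) xs R0 in \<open>auto simp: S_def cnt_def t_def z_def\<close>)
      note this[THEN runs_Seq, OF runs_Seq[OF runs_clear runs_Seq[OF runs_move runs_Inc]]]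
      hence "runs body (S i (Y i) c) (S (Suc i) (Y (Suc i)) c)"
        unfolding body_def
        by (rule runs_eq) (use R0 in \<open>auto simp: S_def z_def cnt_def\<close>)
      moreover have "(S i (Y i) (Suc c))(cnt := c) = S i (Y i) c" "S i (Y i) (Suc c) cnt = Suc c"
        by (auto simp: S_def cnt_def)
      ultimately show ?case
        using Suc.IH Suc.prems i runs_Loop_Suc[of "S i (Y i) (Suc c)" cnt c body "S (Suc i) (Y (Suc i)) c"]
        by (simp add: i_def)
    qed
    from this[of N] have 4: "runs (Loop cnt body) (S 0 (Y 0) N) (S N (Y N) 0)" by simp
    have "s + 1 \<noteq> out" using b by auto
    note runs_move[OF this, of "S N (Y N) 0"]
    note 5 = runs_Seq[OF this runs_Seq[OF runs_clear runs_clears]]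
    show "runs (Seq (copies (b + 1) (s + 2) t m) (Seq (copy b cnt t) (Seq cf
      (Seq (Loop cnt body) (Seq (move (s + 1) out) (Seq (clear s) (clears (s + 2) m))))))) R (R(out := y))"
      by (rule runs_eq[OF runs_Seq[OF 1 runs_Seq[OF 2 runs_Seq[OF 3 runs_Seq[OF 4 5]]]]])
        (use R0 H(4) b Y(1) in \<open>auto simp: S_def cnt_def\<close>)
  qed
  thus ?thesis by blast
qed

lemma implements_Mn:
  assumes f: "\<And>n b out s. b + n \<le> s \<Longrightarrow> out < s \<Longrightarrow> out \<notin> {b..<b + n} \<Longrightarrow> \<exists>c. implements f n c b out s"
    and b: "b + n \<le> s" "out < s" "out \<notin> {b..<b + n}"
  shows "\<exists>c. implements (Mn f) n c b out s"
proof -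
  define z t where "z = s + 1 + n" and "t = s + 2 + n"
  obtain cf where cf: "implements f (n + 1) cf s z t"
    using f[of s "n + 1" t z] by (auto simp: t_def z_def)
  \<comment> \<open>Register \<open>s\<close> holds the candidate and \<open>z\<close> the value of
    \<open>f\<close> there. Entering the loop only decrements \<open>z\<close>, so the rest is
    cleared before the next candidate is tested.\<close>
  define body where "body = Seq (clear z) (Seq (Inc s) cf)"
  have "implements (Mn f) n (Seq (copies b (s + 1) t n) (Seq cf
    (Seq (Loop z body) (Seq (move s out) (clears (s + 1) n))))) b out s"
  proof (rule implementsI)
    fix xs N and R :: "nat \<Rightarrow> nat"
    assume H: "length xs = n" "rec_eval (Mn f) xs N" "\<forall>i<n. R (b + i) = xs ! i" "R out = 0" "\<forall>j\<ge>s. R j = 0"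
    from H(2) have "rec_eval f (N # xs) 0" "\<forall>m<N. \<exists>y. rec_eval f (m # xs) (Suc y)"
      by (auto elim: rec_eval_MnE)
    then obtain Y where Y: "\<And>m. m \<le> N \<Longrightarrow> rec_eval f (m # xs) (Y m)" "Y N = 0" "\<And>m. m < N \<Longrightarrow> 0 < Y m"
    proof -
      assume *: "\<And>Y. (\<And>m. m \<le> N \<Longrightarrow> rec_eval f (m # xs) (Y m)) \<Longrightarrow> Y N = 0 \<Longrightarrow> (\<And>m. m < N \<Longrightarrow> 0 < Y m) \<Longrightarrow> thesis"
      assume 0: "rec_eval f (N # xs) 0" and "\<forall>m<N. \<exists>y. rec_eval f (m # xs) (Suc y)"
      then obtain Z where Z: "\<forall>m<N. rec_eval f (m # xs) (Suc (Z m))" by metis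
      show thesis by (rule *[of "\<lambda>m. if m < N then Suc (Z m) else 0"]) (use 0 Z in auto)
    qed
    define S where "S i v r = (if r = s then i else if s + 1 \<le> r \<and> r < s + 1 + n then xs ! (r - (s + 1))
      else if r = z then v else R r)" for i v r
    have R0: "\<And>r. s \<le> r \<Longrightarrow> R r = 0" using H(5) by blast
    have Rx: "R (b + r - d) = xs ! (r - d)" if "d \<le> r" "r < d + n" for r d
      using H(3)[rule_format, of "r - d"] that by (simp add: less_diff_conv2 add.commute)
    have 1: "runs (copies b (s + 1) t n) R (S 0 0)"
      by (rule runs_eq[OF runs_copies]) (use R0 Rx b in \<open>auto simp: t_def S_def z_def fun_eq_iff\<close>)
    have step: "runs cf (S i 0) (S i (Y i))" if "i \<le> N" for i
    proof -
      have "runs cf (S i 0) ((S i 0)(z := Y i))"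
      proof (rule implementsD[OF cf Y(1)[OF that]])
        show "S i 0 (s + j) = (i # xs) ! j" if "j < n + 1" for j
          using that by (cases j) (auto simp: S_def)
      qed (use H R0 in \<open>auto simp: S_def z_def t_def\<close>)
      thus ?thesis by (rule runs_eq) (auto simp: S_def z_def)
    qed
    have "runs (Loop z body) (S (N - c) (Y (N - c))) (S N 0)" if "c \<le> N" for c
      using that
    proof (induction c)
      case 0
      show ?case by (rule runs_eq[OF runs_Loop_0]) (use Y(2) in \<open>auto simp: S_def z_def\<close>)
    next
      case (Suc c)
      define i where "i = N - Suc c"
      have i: "i < N" "N - c = Suc i" using Suc.prems by (auto simp: i_def)
      then obtain v where v: "Y i = Suc v" using Y(3)[of i] by (cases "Y i") auto
      have "((S i v)(z := 0))(s := Suc (((S i v)(z := 0)) s)) = S (Suc i) 0"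
        by (auto simp: S_def z_def)
      with runs_Seq[OF runs_clear[of z "S i v"] runs_Seq[OF runs_Inc[of s]]] step[of "Suc i"] i
      have "runs body (S i v) (S (Suc i) (Y (Suc i)))" unfolding body_def by simp
      moreover have "(S i (Y i))(z := v) = S i v" "S i (Y i) z = Suc v"
        using v by (auto simp: S_def z_def)
      ultimately show ?case
        using Suc.IH Suc.prems i runs_Loop_Suc[of "S i (Y i)" z v body "S (Suc i) (Y (Suc i))"]
        by (simp add: i_def)
    qed
    from this[of N] have 4: "runs (Loop z body) (S 0 (Y 0)) (S N 0)" by simp
    have "s \<noteq> out" using b by auto
    note 5 = runs_Seq[OF runs_move[OF this, of "S N 0"] runs_clears]
    show "runs (Seq (copies b (s + 1) t n) (Seq cf
      (Seq (Loop z body) (Seq (move s out) (clears (s + 1) n))))) R (R(out := N))"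
      by (rule runs_eq[OF runs_Seq[OF 1 runs_Seq[OF step[OF le0] runs_Seq[OF 4 5]]]])
        (use R0 H(4) b in \<open>auto simp: S_def z_def\<close>)
  qed
  thus ?thesis by blast
qed

text \<open>The induction covers all placements of arguments, result and scratch space, since
  subprograms are laid out elsewhere than the whole program.\<close>

theorem recf_compile:
  "b + n \<le> s \<Longrightarrow> out < s \<Longrightarrow> out \<notin> {b..<b + n} \<Longrightarrow> \<exists>c. implements r n c b out s"
proof (induction r arbitrary: n b out s)
  case Zr
  have "implements Zr n Skip b out s"
  proof (rule implementsI)
    fix xs y and R :: "nat \<Rightarrow> nat"
    assume "rec_eval Zr xs y" "R out = 0"
    hence "R(out := y) = R" by (auto elim!: rec_eval_ZrE)
    thus "runs Skip R (R(out := y))" using runs_Skip by metis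
  qed
  thus ?case by blast
next
  case Sc
  have "implements Sc n (Seq (copy b out s) (Inc out)) b out s"
  proof (rule implementsI)
    fix xs y and R :: "nat \<Rightarrow> nat"
    assume H: "length xs = n" "rec_eval Sc xs y" "\<forall>i<n. R (b + i) = xs ! i" "R out = 0" "\<forall>j\<ge>s. R j = 0"
    have "n = 1" "y = Suc (xs ! 0)" using H(1,2) by (auto elim: rec_eval_ScE)
    thus "runs (Seq (copy b out s) (Inc out)) R (R(out := y))"
      by (intro runs_eq[OF runs_Seq[OF runs_copy runs_Inc]]) (use H Sc in auto)
  qed
  thus ?case by blast
next
  case (Id i)
  have "implements (Id i) n (copy (b + i) out s) b out s"
  proof (rule implementsI)
    fix xs y and R :: "nat \<Rightarrow> nat"
    assume H: "length xs = n" "rec_eval (Id i) xs y" "\<forall>i<n. R (b + i) = xs ! i" "R out = 0" "\<forall>j\<ge>s. R j = 0"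
    have "i < n" "y = xs ! i" using H(1,2) by (auto elim: rec_eval_IdE)
    thus "runs (copy (b + i) out s) R (R(out := y))"
      by (intro runs_eq[OF runs_copy]) (use H Id in auto)
  qed
  thus ?case by blast
next
  case (Cn f gs)
  show ?case by (rule implements_Cn) (use Cn in auto)
next
  case (Pr f g)
  show ?case by (rule implements_Pr) (use Pr in auto)
next
  case (Mn f)
  show ?case by (rule implements_Mn) (use Mn in auto)
qed

section \<open>Pumping\<close>

datatype tree = Leaf nat | Node nat "tree list"

fun tree_root :: "tree \<Rightarrow> nat + nat" where
  "tree_root (Leaf a) = Inl a"
| "tree_root (Node X ts) = Inr X"

fun yld :: "tree \<Rightarrow> nat list" where
  "yld (Leaf a) = [a]"
| "yld (Node X ts) = concat (map yld ts)"

fun labels :: "tree \<Rightarrow> nat set" where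
  "labels (Leaf a) = {}"
| "labels (Node X ts) = insert X (\<Union>c\<in>set ts. labels c)"

fun repeats :: "tree \<Rightarrow> bool" where
  "repeats (Leaf a) = False"
| "repeats (Node X ts) = (\<exists>c\<in>set ts. repeats c \<or> X \<in> labels c)"

fun nodes :: "tree \<Rightarrow> nat" where
  "nodes (Leaf a) = 1"
| "nodes (Node X ts) = Suc (sum_list (map nodes ts))"

fun parse_tree :: "(nat \<times> (nat + nat) list) set \<Rightarrow> tree \<Rightarrow> bool" where
  "parse_tree P (Leaf a) = True"
| "parse_tree P (Node X ts) = ((X, map tree_root ts) \<in> P \<and> (\<forall>c\<in>set ts. parse_tree P c))"

lemma cfg_step_context:
  assumes "(cfg_step P)\<^sup>*\<^sup>* u v"
  shows "(cfg_step P)\<^sup>*\<^sup>* (l @ u @ r) (l @ v @ r)"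
  using assms
proof (induction rule: rtranclp_induct)
  case (step v w)
  from step(2) obtain l' r' X alpha where "(X, alpha) \<in> P" "v = l' @ [Inr X] @ r'" "w = l' @ alpha @ r'"
    by (auto simp: cfg_step_def)
  hence "cfg_step P (l @ v @ r) (l @ w @ r)"
    unfolding cfg_step_def
    by (intro exI[of _ "l @ l'"] exI[of _ "r' @ r"] exI[of _ X] exI[of _ alpha]) auto
  with step(3) show ?case by auto
qed auto

lemma cfg_derives_concat:
  assumes "\<forall>c\<in>set ts. (cfg_step P)\<^sup>*\<^sup>* [f c] (g c)"
  shows "(cfg_step P)\<^sup>*\<^sup>* (map f ts) (concat (map g ts))"
  using assms
proof (induction ts)
  case (Cons c ts)
  have "(cfg_step P)\<^sup>*\<^sup>* ([f c] @ map f ts) (g c @ map f ts)"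
    using cfg_step_context[of P "[f c]" "g c" "[]" "map f ts"] Cons.prems by auto
  moreover have "(cfg_step P)\<^sup>*\<^sup>* (g c @ map f ts) (g c @ concat (map g ts))"
    using cfg_step_context[of P "map f ts" "concat (map g ts)" "g c" "[]"] Cons by auto
  ultimately show ?case by simp
qed auto

lemma parse_tree_derives:
  "parse_tree P t \<Longrightarrow> (cfg_step P)\<^sup>*\<^sup>* [tree_root t] (map Inl (yld t))"
proof (induction t)
  case (Node X ts)
  have "cfg_step P [Inr X] (map tree_root ts)"
    unfolding cfg_step_def using Node.prems
    by (intro exI[of _ "[]"] exI[of _ X] exI[of _ "map tree_root ts"]) auto
  moreover have "(cfg_step P)\<^sup>*\<^sup>* (map tree_root ts) (concat (map (\<lambda>c. map Inl (yld c)) ts))"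
    by (rule cfg_derives_concat) (use Node in auto)
  ultimately show ?case
    by (simp add: map_concat comp_def converse_rtranclp_into_rtranclp)
qed auto

lemma derives_parse_forest:
  assumes "(cfg_step P)\<^sup>*\<^sup>* alpha (map Inl w)"
  shows "\<exists>ts. map tree_root ts = alpha \<and> (\<forall>c\<in>set ts. parse_tree P c) \<and> concat (map yld ts) = w"
  using assms
proof (induction rule: converse_rtranclp_induct)
  case base
  show ?case by (rule exI[of _ "map Leaf w"]) (auto simp: comp_def)
next
  case (step u v)
  then obtain l r X beta where lr: "(X, beta) \<in> P" "u = l @ [Inr X] @ r" "v = l @ beta @ r"
    by (auto simp: cfg_step_def)
  obtain ts where ts: "map tree_root ts = v" "\<forall>c\<in>set ts. parse_tree P c" "concat (map yld ts) = w"
    using step by auto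
  from ts(1)[unfolded lr(3)] obtain tl tb tr where
    "ts = tl @ tb @ tr" "map tree_root tl = l" "map tree_root tb = beta" "map tree_root tr = r"
    unfolding map_eq_append_conv append_eq_map_conv by blast
  with lr ts show ?case by (intro exI[of _ "tl @ [Node X tb] @ tr"]) auto
qed

lemma cfg_lang_parse_tree:
  "w \<in> cfg_lang P S \<longleftrightarrow> (\<exists>t. parse_tree P t \<and> tree_root t = Inr S \<and> yld t = w)"
proof
  assume "w \<in> cfg_lang P S"
  hence "(cfg_step P)\<^sup>*\<^sup>* [Inr S] (map Inl w)" by (simp add: cfg_lang_def)
  from derives_parse_forest[OF this] obtain ts where
    "map tree_root ts = [Inr S]" "\<forall>c\<in>set ts. parse_tree P c" "concat (map yld ts) = w"
    by (elim exE conjE) (rule that)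
  thus "\<exists>t. parse_tree P t \<and> tree_root t = Inr S \<and> yld t = w"
    by (auto simp: map_eq_Cons_conv)
next
  assume "\<exists>t. parse_tree P t \<and> tree_root t = Inr S \<and> yld t = w"
  then obtain t where "parse_tree P t" "tree_root t = Inr S" "yld t = w" by blast
  with parse_tree_derives[of P t] show "w \<in> cfg_lang P S" by (simp add: cfg_lang_def)
qed

text \<open>The tree \<^term>\<open>s\<close> occurs in \<^term>\<open>t\<close> with \<^term>\<open>u\<close> to its left and \<^term>\<open>y\<close> to its right, expressed by
  what happens when the occurrence is replaced.\<close>
definition occurs_at :: "(nat \<times> (nat + nat) list) set \<Rightarrow> tree \<Rightarrow> tree \<Rightarrow> nat list \<Rightarrow> nat list \<Rightarrow> bool" where
  "occurs_at P t s u y \<longleftrightarrow> parse_tree P s \<and> nodes s \<le> nodes t \<and> yld t = u @ yld s @ y \<and>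
     (\<forall>s'. parse_tree P s' \<and> tree_root s' = tree_root s \<longrightarrow>
        (\<exists>t'. parse_tree P t' \<and> tree_root t' = tree_root t \<and> yld t' = u @ yld s' @ y \<and> nodes t' + nodes s = nodes t + nodes s'))"

lemma occurs_at_refl: "parse_tree P t \<Longrightarrow> occurs_at P t t [] []"
  unfolding occurs_at_def by auto

lemma occurs_at_child:
  assumes "parse_tree P (Node X ts)" "c \<in> set ts" "occurs_at P c s u y"
  shows "\<exists>u y. occurs_at P (Node X ts) s u y \<and> nodes s < nodes (Node X ts)"
proof -
  obtain l r where ts: "ts = l @ c # r" using split_list[OF assms(2)] by auto
  let ?u = "concat (map yld l) @ u" and ?y = "y @ concat (map yld r)"
  have "\<exists>t'. parse_tree P t' \<and> tree_root t' = tree_root (Node X ts) \<and> yld t' = ?u @ yld s' @ ?y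
      \<and> nodes t' + nodes s = nodes (Node X ts) + nodes s'"
    if s': "parse_tree P s'" "tree_root s' = tree_root s" for s'
  proof -
    obtain c' where c': "parse_tree P c'" "tree_root c' = tree_root c" "yld c' = u @ yld s' @ y"
      "nodes c' + nodes s = nodes c + nodes s'"
      using assms(3) s' unfolding occurs_at_def by auto
    show ?thesis
      by (rule exI[of _ "Node X (l @ c' # r)"]) (use c' assms(1) ts in auto)
  qed
  moreover have "parse_tree P s \<and> nodes s < nodes (Node X ts) \<and> yld (Node X ts) = ?u @ yld s @ ?y"
    using assms(3) ts by (auto simp: occurs_at_def)
  ultimately show ?thesis unfolding occurs_at_def by (metis less_imp_le)
qed

lemma occurs_at_label:
  "parse_tree P t \<Longrightarrow> X \<in> labels t \<Longrightarrow> \<exists>s u y. occurs_at P t s u y \<and> tree_root s = Inr X"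
proof (induction t)
  case (Node Y ts)
  show ?case
  proof (cases "X = Y")
    case True
    thus ?thesis using occurs_at_refl[OF Node.prems(1)] by fastforce
  next
    case False
    then obtain c where c: "c \<in> set ts" "X \<in> labels c" using Node.prems by auto
    then obtain s u y where "occurs_at P c s u y" "tree_root s = Inr X" using Node by fastforce
    thus ?thesis using occurs_at_child[OF Node.prems(1) c(1)] by blast
  qed
qed auto

text \<open>Descend into a child as long as some child contains a repeat. Where the descent ends,
  the label of the node itself recurs below, and the repeat-free children will bound the length of
  the pumped window.\<close>

lemma occurs_at_lowest_repeat:
  "parse_tree P t \<Longrightarrow> repeats t \<Longrightarrow> \<exists>X ts u y. occurs_at P t (Node X ts) u y
     \<and> (\<forall>c\<in>set ts. \<not> repeats c) \<and> (\<exists>c\<in>set ts. X \<in> labels c)"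
proof (induction t)
  case (Node X ts)
  show ?case
  proof (cases "\<exists>c\<in>set ts. repeats c")
    case True
    then obtain c where c: "c \<in> set ts" "repeats c" by auto
    then obtain Y ss u y where "occurs_at P c (Node Y ss) u y"
      "\<forall>c\<in>set ss. \<not> repeats c" "\<exists>c\<in>set ss. Y \<in> labels c"
      using Node by (metis parse_tree.simps(2))
    thus ?thesis using occurs_at_child[OF Node.prems(1) c(1)] by blast
  next
    case False
    thus ?thesis using occurs_at_refl[OF Node.prems(1)] Node.prems(2)
      by (intro exI[of _ X] exI[of _ ts] exI[of _ "[]"]) auto
  qed
qed auto

lemma length_concat_bound:
  assumes "\<forall>c\<in>set ts. length (f c) \<le> b"
  shows "length (concat (map f ts)) \<le> length ts * b"
  using assms by (induction ts) auto

lemma labels_subset_fst: "parse_tree P t \<Longrightarrow> labels t \<subseteq> fst ` P"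
proof (induction t)
  case (Node X ts)
  hence "X \<in> fst ` P" by (force intro: rev_image_eqI)
  with Node show ?case by auto
qed simp

text \<open>\<open>V\<close> stands for the labels of the ancestors. Without repeats each level uses
  up one more left-hand side, which bounds the depth, while \<open>b\<close> bounds the
  branching.\<close>

lemma yld_length_no_repeat:
  assumes "finite P" "\<forall>(X, alpha)\<in>P. length alpha \<le> b" "1 \<le> b"
  shows "parse_tree P t \<Longrightarrow> \<not> repeats t \<Longrightarrow> labels t \<inter> V = {} \<Longrightarrow>
    length (yld t) \<le> b ^ card (fst ` P - V)"
proof (induction t arbitrary: V)
  case (Leaf a)
  thus ?case using assms(3) by simp
next
  case (Node X ts)
  have "X \<in> fst ` P - V"
    using labels_subset_fst[OF Node.prems(1)] Node.prems(3) by auto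
  with card_Suc_Diff1[of "fst ` P - V" X]
  have card: "card (fst ` P - V) = Suc (card (fst ` P - insert X V))"
    using assms(1) by (simp add: Diff_insert[symmetric])
  have "\<forall>c\<in>set ts. length (yld c) \<le> b ^ card (fst ` P - insert X V)"
    using Node by (intro ballI Node.IH) auto
  from length_concat_bound[OF this] have "length (yld (Node X ts)) \<le> length ts * b ^ card (fst ` P - insert X V)"
    by simp
  also have "\<dots> \<le> b * b ^ card (fst ` P - insert X V)"
  proof (intro mult_right_mono)
    show "length ts \<le> b" using assms(2) Node.prems(1) by auto
  qed simp
  finally show ?case using card by simp
qed

text \<open>Grammars may have erasing and unit rules, so a repeat need not contribute a letter.
  Nonemptiness comes from a parse tree with the fewest nodes: if \<open>v @ x\<close> were empty,
  cutting out the repeat would give a smaller tree for the same word. Exponents 0 and 2 are all that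
  the gap argument asks for.\<close>

theorem context_free_pumping:
  assumes "context_free_lang L"
  shows "\<exists>p. \<forall>z\<in>L. p \<le> length z \<longrightarrow> (\<exists>u v w x y. z = u @ v @ w @ x @ y \<and> v @ x \<noteq> [] \<and>
    length (v @ w @ x) \<le> p \<and> u @ w @ y \<in> L \<and> u @ v @ v @ w @ x @ x @ y \<in> L)"
proof -
  obtain P S where P: "finite P" "L = cfg_lang P S" using assms by (auto simp: context_free_lang_def)
  define b where "b = Suc (\<Sum>q\<in>P. length (snd q))"
  have "length (snd q) \<le> b" if "q \<in> P" for q
    using member_le_sum[of q P "\<lambda>q. length (snd q)"] P(1) that by (simp add: b_def)
  hence b: "\<forall>(X, alpha)\<in>P. length alpha \<le> b" "1 \<le> b" by (auto simp: b_def)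
  note bound = yld_length_no_repeat[OF P(1) b, of _ "{}"]
  define p where "p = Suc (b * b ^ card (fst ` P))"
  have "\<exists>u v w x y. z = u @ v @ w @ x @ y \<and> v @ x \<noteq> [] \<and>
    length (v @ w @ x) \<le> p \<and> u @ w @ y \<in> L \<and> u @ v @ v @ w @ x @ x @ y \<in> L"
    if z: "z \<in> L" "p \<le> length z" for z
  proof -
    let ?T = "\<lambda>t. parse_tree P t \<and> tree_root t = Inr S \<and> yld t = z"
    obtain t0 where "?T t0" using z(1) P(2) cfg_lang_parse_tree by auto
    then obtain t where t: "?T t" and min: "\<And>t'. ?T t' \<Longrightarrow> nodes t \<le> nodes t'"
      using ex_has_least_nat[of ?T t0 nodes] by auto
    have "repeats t"
    proof (rule ccontr)
      assume "\<not> repeats t"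
      hence "length z \<le> b ^ card (fst ` P)" using bound[of t] t by simp
      also have "\<dots> \<le> b * b ^ card (fst ` P)" using b(2) by simp
      finally show False using z(2) by (simp add: p_def)
    qed
    then obtain X ts u y where occ: "occurs_at P t (Node X ts) u y"
      and nr: "\<forall>c\<in>set ts. \<not> repeats c" and "\<exists>c\<in>set ts. X \<in> labels c"
      using occurs_at_lowest_repeat t by blast
    then obtain c where c: "c \<in> set ts" "X \<in> labels c" by auto
    have pt: "parse_tree P (Node X ts)" using occ by (simp add: occurs_at_def)
    then obtain s v0 x0 where "occurs_at P c s v0 x0" and rs: "tree_root s = Inr X"
      using occurs_at_label[of P c X] c by auto
    then obtain v x where occ2: "occurs_at P (Node X ts) s v x" and lt: "nodes s < nodes (Node X ts)"
      using occurs_at_child[OF pt c(1)] by blast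
    have pts: "parse_tree P s" using occ2 by (simp add: occurs_at_def)
    have yX: "yld (Node X ts) = v @ yld s @ x" using occ2 by (simp add: occurs_at_def)
    have yt: "z = u @ v @ yld s @ x @ y" using occ t yX by (simp add: occurs_at_def)
    have plug: "\<exists>t'. parse_tree P t' \<and> tree_root t' = Inr S \<and> yld t' = u @ yld s' @ y \<and>
       nodes t' + nodes (Node X ts) = nodes t + nodes s'"
      if "parse_tree P s'" "tree_root s' = Inr X" for s'
      using occ that t unfolding occurs_at_def by (metis tree_root.simps(2))
    obtain t1 where t1: "parse_tree P t1" "tree_root t1 = Inr S" "yld t1 = u @ yld s @ y"
       "nodes t1 + nodes (Node X ts) = nodes t + nodes s" using plug[OF pts rs] by auto
    \<comment> \<open>The outer tree with root \<open>X\<close> is put in the place of the inner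
      one.\<close>
    obtain s2 where "parse_tree P s2" "tree_root s2 = Inr X" "yld s2 = v @ (v @ yld s @ x) @ x"
      using occ2 pt rs yX unfolding occurs_at_def by (metis tree_root.simps(2))
    then obtain t2 where t2: "parse_tree P t2" "tree_root t2 = Inr S" "yld t2 = u @ v @ v @ yld s @ x @ x @ y"
      using plug by fastforce
    have "v @ x \<noteq> []"
    proof
      assume "v @ x = []"
      hence "yld t1 = z" using t1(3) yt by simp
      thus False using min[of t1] t1 lt by simp
    qed
    moreover have "length (v @ yld s @ x) \<le> p"
    proof -
      have "\<forall>c\<in>set ts. length (yld c) \<le> b ^ card (fst ` P)" using nr pt bound by simp
      from length_concat_bound[OF this] have "length (yld (Node X ts)) \<le> length ts * b ^ card (fst ` P)" by simp
      also have "\<dots> \<le> b * b ^ card (fst ` P)"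
      proof (intro mult_right_mono)
        show "length ts \<le> b" using b(1) pt by auto
      qed simp
      finally show ?thesis using yX by (simp add: p_def)
    qed
    moreover have "u @ yld s @ y \<in> L" using t1 P(2) cfg_lang_parse_tree by auto
    moreover have "u @ v @ v @ yld s @ x @ x @ y \<in> L" using t2 P(2) cfg_lang_parse_tree by auto
    ultimately show ?thesis using yt by blast
  qed
  thus ?thesis by blast
qed

section \<open>Two-letter languages with gaps\<close>

lemma bstar_two: "bstar [a, b] = {replicate m a @ replicate n b | m n. True}"
proof -
  have len: "length ns = length [a, b] \<longleftrightarrow> (\<exists>m n. ns = [m, n])" for ns :: "nat list"
    by (auto simp: length_Suc_conv)
  have "bstar [a, b] = (\<lambda>ns. concat (map (\<lambda>(a, n). replicate n a) (zip [a, b] ns))) ` {[m, n] | m n. True}"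
    unfolding bstar_def len by blast
  also have "\<dots> = {replicate m a @ replicate n b | m n. True}"
    by (force simp: image_iff)
  finally show ?thesis .
qed

text \<open>For the given \<open>m\<close> the least possible \<open>n\<close> is taken. If the
  pumped parts contain an \<open>a\<close>, pumping up lands in the gap after \<open>m\<close>;
  otherwise they consist of letters \<open>b\<close>, and pumping down contradicts the choice of
  \<open>n\<close>.\<close>

lemma not_context_free_gaps:
  assumes ab: "a \<noteq> b" and L: "L \<subseteq> bstar [a, b]"
    and gaps: "\<And>p. \<exists>m n. p \<le> m \<and> replicate m a @ replicate n b \<in> L \<and>
       (\<forall>m' n'. m < m' \<longrightarrow> m' \<le> m + p \<longrightarrow> replicate m' a @ replicate n' b \<notin> L)"
  shows "\<not> context_free_lang L"
proof
  assume "context_free_lang L"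
  from context_free_pumping[OF this] obtain p where pump: "\<forall>z\<in>L. p \<le> length z \<longrightarrow>
    (\<exists>u v w x y. z = u @ v @ w @ x @ y \<and> v @ x \<noteq> [] \<and>
    length (v @ w @ x) \<le> p \<and> u @ w @ y \<in> L \<and> u @ v @ v @ w @ x @ x @ y \<in> L)" by blast
  obtain m n0 where m: "p \<le> m" "replicate m a @ replicate n0 b \<in> L"
    "\<And>m' n'. m < m' \<Longrightarrow> m' \<le> m + p \<Longrightarrow> replicate m' a @ replicate n' b \<notin> L" using gaps by blast
  define n where "n = (LEAST n. replicate m a @ replicate n b \<in> L)"
  have n: "replicate m a @ replicate n b \<in> L" unfolding n_def using m(2) by (rule LeastI)
  obtain u v w x y where d: "replicate m a @ replicate n b = u @ v @ w @ x @ y" "v @ x \<noteq> []"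
    "length (v @ w @ x) \<le> p" "u @ w @ y \<in> L" "u @ v @ v @ w @ x @ x @ y \<in> L"
    using pump n m(1) by fastforce
  obtain m1 n1 where d1: "u @ w @ y = replicate m1 a @ replicate n1 b" using d(4) L bstar_two by blast
  obtain m2 n2 where d2: "u @ v @ v @ w @ x @ x @ y = replicate m2 a @ replicate n2 b"
    using d(5) L bstar_two by blast
  define va vb where "va = count_list (v @ x) a" and "vb = count_list (v @ x) b"
  have cnt: "count_list (replicate k c) c' = (if c = c' then k else 0)" for k and c c' :: nat
    by (induction k) auto
  have A: "m = count_list (u @ w @ y) a + va" "n = count_list (u @ w @ y) b + vb"
    using arg_cong[OF d(1), of "\<lambda>z. count_list z a"] arg_cong[OF d(1), of "\<lambda>z. count_list z b"] ab
    by (auto simp: cnt va_def vb_def)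
  have A1: "count_list (u @ w @ y) a = m1" "count_list (u @ w @ y) b = n1"
    using ab by (simp_all add: d1 cnt)
  have A2: "m2 = m + va"
    using arg_cong[OF d2, of "\<lambda>z. count_list z a"] A(1) ab by (simp add: cnt va_def)
  show False
  proof (cases "va = 0")
    case False
    have "va \<le> p" using d(3) count_le_length[of "v @ x" a] by (simp add: va_def)
    thus False using m(3)[of m2 n2] d(5) d2 A2 False by (simp del: append_assoc)
  next
    case True
    have "set (v @ x) \<subseteq> {a, b}"
      using arg_cong[OF d(1), of set] by (auto split: if_splits)
    moreover have "a \<notin> set (v @ x)" using True by (simp add: va_def count_list_0_iff)
    ultimately have "b \<in> set (v @ x)" using d(2) by (metis insert_iff list.set_intros(1) neq_Nil_conv singletonD subsetD)
    hence "vb \<noteq> 0" by (auto simp: vb_def count_list_0_iff)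
    moreover have "n \<le> n1" unfolding n_def by (rule Least_le) (use d(4) d1 A A1 True in auto)
    ultimately show False using A A1 by simp
  qed
qed

text \<open>Two of the shortest \<open>card Q + 1\<close> powers of \<open>a\<close> lead to the
  same state. Hence at most \<open>card Q\<close> further letters \<open>a\<close> can be inserted
  into an accepted word, which leads into the gap.\<close>

lemma not_regular_gaps:
  assumes gaps: "\<And>p. \<exists>m n. p \<le> m \<and> replicate m a @ replicate n b \<in> L \<and>
       (\<forall>m' n'. m < m' \<longrightarrow> m' \<le> m + p \<longrightarrow> replicate m' a @ replicate n' b \<notin> L)"
  shows "\<not> regular_lang L"
proof
  assume "regular_lang L"
  then obtain A Q F and q0 :: nat and dl :: "nat \<Rightarrow> nat \<Rightarrow> nat" where
    reg: "L \<subseteq> lists A" "finite Q" "q0 \<in> Q" "\<forall>q\<in>Q. \<forall>a\<in>A. dl q a \<in> Q"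
    "\<forall>w\<in>lists A. w \<in> L \<longleftrightarrow> fold (\<lambda>a q. dl q a) w q0 \<in> F" unfolding regular_lang_def by auto
  define st where "st i = fold (\<lambda>a q. dl q a) (replicate i a) q0" for i
  have st_add: "st (i + j) = fold (\<lambda>a q. dl q a) (replicate j a) (st i)" for i j
    by (simp add: st_def replicate_add)
  have "a \<in> A"
  proof -
    obtain m n where "1 \<le> m" "replicate m a @ replicate n b \<in> L" using gaps by blast
    thus ?thesis using reg(1) by (cases m) auto
  qed
  hence stQ: "st i \<in> Q" for i
    using reg(3,4) by (induction i) (auto simp: st_def replicate_append_same[symmetric] simp del: replicate_append_same)
  have "\<not> inj_on st {..card Q}"
    using stQ card_inj_on_le[of st "{..card Q}" Q] reg(2) by auto
  then obtain i j where ij: "i < j" "st i = st j" "j \<le> card Q"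
    unfolding inj_on_def by (metis atMost_iff linorder_neqE_nat)
  obtain m n where m: "card Q \<le> m" "replicate m a @ replicate n b \<in> L"
    "\<And>m' n'. m < m' \<Longrightarrow> m' \<le> m + card Q \<Longrightarrow> replicate m' a @ replicate n' b \<notin> L" using gaps by blast
  have "st m = st (m + (j - i))"
  proof -
    have "m = i + (m - i)" "m + (j - i) = j + (m - i)" using ij m(1) by auto
    thus ?thesis using st_add[of i "m - i"] st_add[of j "m - i"] ij(2) by simp
  qed
  moreover have "replicate (m + (j - i)) a @ replicate n b \<in> lists A"
    using m(2) reg(1) \<open>a \<in> A\<close> by auto
  ultimately have "replicate (m + (j - i)) a @ replicate n b \<in> L"
    using m(2) reg(1,5) by (metis fold_append comp_apply st_def subsetD)
  moreover have "m < m + (j - i)" "m + (j - i) \<le> m + card Q" using ij by auto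
  ultimately show False using m(3) by blast
qed

section \<open>Automata driven by rays\<close>

text \<open>The input letters are \<open>LetterA\<close> and \<open>Chain d\<close>; the latter is
  the letter \<open>b\<close> and the start of the countdown in one. \<open>Col\<close> holds the
  ray timers, the mark, and the message to be sent next. \<open>Final\<close> is the wave set off by
  the end marker, carrying the verdict of the cell that it has just reached.\<close>

datatype 'q cell = LetterA | Col "nat list" "'q option" "'q option" | Dead | Final bool | BEnd | Chain nat
datatype 'q message = MsgA | MsgEnd | Signal "nat set" "'q option"

text \<open>A signal without content must be silence, otherwise every column would communicate in
  every step.\<close>

definition signal :: "nat set \<Rightarrow> 'q option \<Rightarrow> 'q message option" where
  "signal E h = (if E = {} \<and> h = None then None else Some (Signal E h))"

text \<open>\<open>stop q E\<close> is the new control if a message with control \<open>q\<close>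
  has to end in a column where exactly the rays \<open>E\<close> arrive, and \<open>None\<close> if
  it passes on. A marked column launches its message when ray \<open>bi\<close> arrives.\<close>

locale ray_oca =
  fixes nr :: nat and slope :: "nat \<Rightarrow> nat" and bi :: nat
    and stop :: "'q \<Rightarrow> nat set \<Rightarrow> 'q option" and C :: "'q set" and q0 :: 'q and F :: "'q set" and pol :: bool
  assumes finite_C: "finite C" and q0: "q0 \<in> C"
    and stop_closed: "q \<in> C \<Longrightarrow> stop q E = Some q' \<Longrightarrow> q' \<in> C"
    and bi: "bi < nr"
begin

text \<open>The timer of ray \<^term>\<open>j\<close> in a column is 0 before the ray arrives, 1 in the step of its
  arrival, \<^term>\<open>Suc (slope j)\<close> in the step in which it is handed on, and \<^term>\<open>slope j + 2\<close> from then on.\<close>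
definition col_step :: "nat list \<Rightarrow> 'q option \<Rightarrow> nat set \<Rightarrow> 'q option \<Rightarrow> 'q cell" where
  "col_step ts mk E h =
    (let ts' = map (\<lambda>j. if j \<in> E then 1 else if ts ! j = 0 then 0 else min (Suc (ts ! j)) (slope j + 2)) [0..<nr];
         ev = {j. j < nr \<and> ts' ! j = 1}
     in case h of None \<Rightarrow> Col ts' mk (if bi \<in> ev then mk else None)
        | Some q \<Rightarrow> (case stop q ev of None \<Rightarrow> Col ts' mk (Some q) | Some q' \<Rightarrow> Col ts' (Some q') None))"

fun emit :: "'q cell \<Rightarrow> 'q message option" where
  "emit LetterA = Some MsgA"
| "emit (Col ts mk fw) = signal {j. j < nr \<and> ts ! j = Suc (slope j)} fw"
| "emit (Final b) = Some MsgEnd"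
| "emit (Chain 0) = signal {} (Some q0)"
| "emit s = None"

text \<open>Evaluated in the last state before the wave arrives. Polarity \<open>False\<close> gives
  the complementary verdict.\<close>

definition good :: "'q cell \<Rightarrow> bool" where
  "good s \<longleftrightarrow> (\<exists>ts q fw. s = Col ts (Some q) fw \<and> q \<in> F) = pol"

text \<open>In the first step an \<open>a\<close>-cell that hears nothing has a \<open>b\<close> to
  its right; it becomes column 0, where all rays start, hence the timers 1. \<open>MsgA\<close>
  tells the other \<open>a\<close>-cells that they are later columns. A countdown cell that hears it
  is followed by an \<open>a\<close> and dies.\<close>

fun trans_inner :: "'q cell \<Rightarrow> 'q message option \<Rightarrow> 'q cell" where
  "trans_inner LetterA None = Col (replicate nr 1) None None"
| "trans_inner LetterA (Some MsgA) = Col (replicate nr 0) None None"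
| "trans_inner (Col ts mk fw) (Some (Signal E h)) = col_step ts mk E h"
| "trans_inner (Col ts mk fw) _ = col_step ts mk {} None"
| "trans_inner (Chain 0) _ = BEnd"
| "trans_inner (Chain (Suc i)) None = Chain i"
| "trans_inner BEnd _ = BEnd"
| "trans_inner _ _ = Dead"

definition trans :: "'q cell \<Rightarrow> 'q message option \<Rightarrow> 'q cell" where
  "trans s x = (if s = Dead \<or> s \<in> range Final then Dead
     else if x = Some MsgEnd then Final (good s) else trans_inner s x)"

lemma trans_col_signal: "trans (Col ts mk fw) (signal E h) = col_step ts mk E h"
  by (auto simp: trans_def signal_def)

fun aconf :: "'q cell list \<Rightarrow> nat \<Rightarrow> 'q cell list" where
  "aconf w 0 = w"
| "aconf w (Suc t) = (let c = aconf w t in map (\<lambda>i. trans (c ! i)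
     (if Suc i = length w then (if t = 0 then Some MsgEnd else None) else emit (c ! Suc i))) [0..<length w])"

lemma length_aconf [simp]: "length (aconf w t) = length w"
  by (cases t) (auto simp: Let_def)

lemma aconf_Suc_nth:
  "i < length w \<Longrightarrow> aconf w (Suc t) ! i = trans (aconf w t ! i)
     (if Suc i = length w then (if t = 0 then Some MsgEnd else None) else emit (aconf w t ! Suc i))"
  by (simp add: Let_def)

lemma emit_MsgEnd: "emit s = Some MsgEnd \<Longrightarrow> s \<in> range Final"
  by (cases s rule: emit.cases) (auto simp: signal_def split: if_splits)

lemma trans_Final: "trans s x \<in> range Final \<Longrightarrow> x = Some MsgEnd"
proof (rule ccontr)
  assume "trans s x \<in> range Final" "x \<noteq> Some MsgEnd"
  hence "trans_inner s x \<in> range Final" by (auto simp: trans_def split: if_splits)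
  thus False
    by (cases "(s, x)" rule: trans_inner.cases)
      (auto simp: col_step_def Let_def split: option.splits if_splits)
qed

text \<open>The \<open>b\<close> in front of an \<open>a\<close> dies in the first step and sends
  nothing from then on, so the end wave cannot get past it.\<close>

lemma descent_not_Final:
  assumes "Suc i < length w" "w ! i = Chain (Suc d)" "w ! Suc i = LetterA"
    and "\<And>p. p \<le> i \<Longrightarrow> w ! p \<notin> range Final"
  shows "(0 < t \<longrightarrow> aconf w t ! i = Dead) \<and> (\<forall>p\<le>i. aconf w t ! p \<notin> range Final)"
proof (induction t)
  case (Suc t)
  have i: "aconf w (Suc t) ! i = Dead"
  proof (cases "t = 0")
    case True
    thus ?thesis using assms by (subst aconf_Suc_nth) (auto simp: trans_def)
  next
    case False
    thus ?thesis using assms Suc by (subst aconf_Suc_nth) (auto simp: trans_def)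
  qed
  have "aconf w (Suc t) ! p \<notin> range Final" if "p < i" for p
  proof
    assume "aconf w (Suc t) ! p \<in> range Final"
    hence "emit (aconf w t ! Suc p) = Some MsgEnd"
      using trans_Final assms(1) that by (subst (asm) aconf_Suc_nth) force+
    thus False using emit_MsgEnd Suc that by (metis Suc_leI)
  qed
  thus ?case using i by (auto simp: le_less)
qed (use assms in auto)

end

text \<open>Leg \<open>n\<close> of the message carries the control \<open>kap n\<close> along row
  \<open>rho n\<close> and ends in column \<open>us n\<close>. There the next leg starts on ray
  \<open>bi\<close>, in row \<open>slope bi * us n\<close>; by \<open>rho_less\<close> the mark is
  set before this ray arrives.\<close>

locale ray_orbit = ray_oca nr slope bi stop C q0 F pol
  for nr slope bi and stop :: "'q \<Rightarrow> nat set \<Rightarrow> 'q option" and C q0 F pol +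
  fixes d :: nat and kap :: "nat \<Rightarrow> 'q" and rho us :: "nat \<Rightarrow> nat"
  assumes d_pos: "0 < d" and rho_0: "rho 0 = d" and rho_Suc: "rho (Suc n) = slope bi * us n"
    and kap_0: "kap 0 = q0" and us_pos: "0 < us 0" and us_Suc: "us n < us (Suc n)"
    and rho_less: "rho n < slope bi * us n"
    and stop_pass: "n = 0 \<or> us (n - 1) < u \<Longrightarrow> u < us n \<Longrightarrow> stop (kap n) {j. j < nr \<and> slope j * u = rho n} = None"
    and stop_hit: "stop (kap n) {j. j < nr \<and> slope j * us n = rho n} = Some (kap (Suc n))"
begin

lemma us_mono: "strict_mono us"
  using us_Suc by (simp add: strict_mono_Suc_iff)

text \<open>The leg on which a message leaves column \<open>u\<close>. By the strict inequality a
  turning column \<open>us n\<close> belongs to leg \<open>Suc n\<close>, since what leaves it is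
  the next message.\<close>

definition leg :: "nat \<Rightarrow> nat" where "leg u = (LEAST n. u < us n)"

lemma less_us_leg: "u < us (leg u)"
proof -
  have "u \<le> us u" using us_mono by (rule strict_mono_imp_increasing)
  hence "u < us (Suc u)" using us_Suc[of u] by simp
  thus ?thesis unfolding leg_def by (rule LeastI)
qed

lemma leg_eq: "u < us n \<Longrightarrow> n = 0 \<or> us (n - 1) \<le> u \<Longrightarrow> leg u = n"
  unfolding leg_def
proof (rule Least_equality)
  fix m assume *: "n = 0 \<or> us (n - 1) \<le> u" "u < us m"
  show "n \<le> m"
  proof (rule ccontr)
    assume "\<not> n \<le> m"
    hence "us m \<le> us (n - 1)" by (intro strict_mono_leD[OF us_mono]) auto
    thus False using * \<open>\<not> n \<le> m\<close> by auto
  qed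
qed

lemma us_leg_le: "leg u \<noteq> 0 \<Longrightarrow> us (leg u - 1) \<le> u"
  using not_less_Least[of "leg u - 1" "\<lambda>n. u < us n"] by (fastforce simp: leg_def)

lemma leg_us: "leg (us n) = Suc n"
  by (rule leg_eq) (use us_Suc in auto)

definition mark :: "nat \<Rightarrow> nat \<Rightarrow> 'q option" where
  "mark u t = (if 0 < leg u \<and> us (leg u - 1) = u \<and> u + rho (leg u - 1) < t then Some (kap (leg u)) else None)"

definition forward :: "nat \<Rightarrow> nat \<Rightarrow> 'q option" where
  "forward u t = (if t = Suc (u + rho (leg u)) then Some (kap (leg u)) else None)"

text \<open>Closed form of the timers kept by \<open>col_step\<close>: truncated subtraction gives 0
  before the arrival, and the minimum freezes the timer after the ray has been handed on.\<close>

definition timers :: "nat \<Rightarrow> nat \<Rightarrow> nat list" where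
  "timers u t = map (\<lambda>j. min (t - u - slope j * u) (slope j + 2)) [0..<nr]"

lemma timers_nth: "j < nr \<Longrightarrow> timers u t ! j = min (t - u - slope j * u) (slope j + 2)"
  by (simp add: timers_def)

definition column :: "nat \<Rightarrow> nat \<Rightarrow> 'q cell" where
  "column u t = Col (timers u t) (mark u t) (forward u t)"

text \<open>Rays originate in column 0 and do not arrive there, hence \<open>0 < u\<close>.\<close>

definition arriving :: "nat \<Rightarrow> nat \<Rightarrow> nat set" where
  "arriving u t = {j. j < nr \<and> 0 < u \<and> t = u + slope j * u}"

text \<open>A message that enters column \<open>u\<close> has left column \<open>u - 1\<close>. In a
  turning column this is the leg that ends there, whereas \<open>leg u\<close> is already the next
  one.\<close>

definition incoming :: "nat \<Rightarrow> nat \<Rightarrow> 'q option" where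
  "incoming u t = (let n = (if u = 0 then 0 else leg (u - 1)) in if t = u + rho n then Some (kap n) else None)"

lemma emit_column: "emit (column u t) = signal (arriving (Suc u) t) (incoming (Suc u) t)"
proof -
  have "{j. j < nr \<and> timers u t ! j = Suc (slope j)} = arriving (Suc u) t"
    unfolding arriving_def by (rule Collect_cong) (auto simp: timers_nth min_def split: if_splits)
  thus ?thesis by (simp add: column_def forward_def incoming_def)
qed

text \<open>The countdown acts as a virtual column to the right of column 0 that launches leg 0 in
  row \<open>d\<close>.\<close>

lemma emit_chain: "emit (if t \<le> d then Chain (d - t) else BEnd) = signal (arriving 0 t) (incoming 0 t)"
proof -
  consider "t < d" | "t = d" | "d < t" by linarith
  thus ?thesis
  proof cases
    case 1
    then obtain k where "d - t = Suc k" by (metis Suc_diff_Suc)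
    thus ?thesis using 1 rho_0 by (simp add: arriving_def incoming_def signal_def)
  qed (use rho_0 kap_0 in \<open>auto simp: arriving_def incoming_def signal_def\<close>)
qed

text \<open>The closed form obeys the local rule. A column strictly inside a leg passes the message
  on. A turning column \<open>us n\<close> sets its mark in row \<open>rho n\<close>, and strictly
  later ray \<open>bi\<close> turns the mark into the next message.\<close>

lemma column_step:
  assumes t: "0 < t"
  shows "col_step (timers u t) (mark u t) (arriving u t) (incoming u t) = column u (Suc t)"
proof -
  define ts' where "ts' = map (\<lambda>j. if j \<in> arriving u t then 1 else if timers u t ! j = 0 then 0
    else min (Suc (timers u t ! j)) (slope j + 2)) [0..<nr]"
  define ev where "ev = {j. j < nr \<and> ts' ! j = 1}"
  have ts': "ts' = timers u (Suc t)"
    unfolding ts'_def timers_def arriving_def using t by (intro map_cong refl) (auto simp: min_def)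
  have ev: "ev = {j. j < nr \<and> t = u + slope j * u}"
    unfolding ev_def ts' by (rule Collect_cong) (auto simp: timers_nth min_def split: if_splits)
  define n where "n = (if u = 0 then 0 else leg (u - 1))"
  have inc: "incoming u t = (if t = u + rho n then Some (kap n) else None)"
    by (simp add: incoming_def n_def)
  have n1: "u \<le> us n" using less_us_leg[of "u - 1"] by (auto simp: n_def)
  have n2: "n = 0 \<or> us (n - 1) < u"
  proof (cases "n = 0")
    case False
    hence "0 < u" "us (n - 1) \<le> u - 1" using us_leg_le[of "u - 1"] by (auto simp: n_def split: if_splits)
    thus ?thesis by linarith
  qed simp
  have step: "col_step (timers u t) (mark u t) (arriving u t) (incoming u t) =
    (case incoming u t of None \<Rightarrow> Col ts' (mark u t) (if bi \<in> ev then mark u t else None)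
        | Some q \<Rightarrow> (case stop q ev of None \<Rightarrow> Col ts' (mark u t) (Some q) | Some q' \<Rightarrow> Col ts' (Some q') None))"
    unfolding col_step_def ts'_def[symmetric] Let_def ev_def[symmetric] ..
  show ?thesis
  proof (cases "u = us n")
    case False
    hence u: "u < us n" using n1 by simp
    have leg: "leg u = n" using u n2 by (intro leg_eq) auto
    have mark: "mark u t' = None" for t'
      using n2 by (auto simp: mark_def leg)
    show ?thesis
    proof (cases "t = u + rho n")
      case True
      hence "ev = {j. j < nr \<and> slope j * u = rho n}" by (auto simp: ev)
      hence "stop (kap n) ev = None" using stop_pass n2 u by simp
      moreover have "incoming u t = Some (kap n)" unfolding inc using True by simp
      moreover have "forward u (Suc t) = Some (kap n)" unfolding forward_def leg using True by simp
      ultimately show ?thesis by (subst step) (simp add: column_def ts' mark)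
    next
      case False
      thus ?thesis by (subst step) (simp add: inc column_def ts' mark forward_def leg)
    qed
  next
    case u: True
    have leg: "leg u = Suc n" using leg_us u by simp
    have mark: "mark u t' = (if u + rho n < t' then Some (kap (Suc n)) else None)" for t'
      unfolding mark_def leg using u by simp
    have rl: "rho n < slope bi * u" using rho_less u by simp
    have fw: "forward u (Suc t) = (if t = u + slope bi * u then Some (kap (Suc n)) else None)"
      unfolding forward_def leg rho_Suc using u by simp
    show ?thesis
    proof (cases "t = u + rho n")
      case True
      hence "ev = {j. j < nr \<and> slope j * us n = rho n}" by (auto simp: ev u)
      hence "stop (kap n) ev = Some (kap (Suc n))" using stop_hit by simp
      moreover have "incoming u t = Some (kap n)" unfolding inc using True by simp
      moreover have "forward u (Suc t) = None" unfolding fw using True rl by simp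
      moreover have "u + rho n < Suc t" using True by simp
      ultimately show ?thesis by (subst step) (simp add: column_def ts' mark)
    next
      case False
      have "bi \<in> ev \<longleftrightarrow> t = u + slope bi * u" using bi by (simp add: ev)
      thus ?thesis using False rl by (subst step) (auto simp: inc column_def ts' mark fw)
    qed
  qed
qed

lemma column_first: "trans LetterA None = column 0 1"
proof -
  have "leg 0 = 0" using us_pos by (intro leg_eq) auto
  thus ?thesis using d_pos rho_0
    by (auto simp: trans_def column_def timers_def mark_def forward_def min_def map_replicate_const)
qed

lemma column_later: "0 < u \<Longrightarrow> trans LetterA (Some MsgA) = column u 1"
  by (auto simp: trans_def column_def timers_def mark_def forward_def min_def map_replicate_const)

text \<open>The contents of cell \<open>i\<close> if the block of letters \<open>b\<close> went on
  forever, that is, without any influence of the end marker.\<close>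

definition normal :: "nat \<Rightarrow> nat \<Rightarrow> nat \<Rightarrow> 'q cell" where
  "normal m t i = (if i < m then (if t = 0 then LetterA else column (m - 1 - i) t)
     else (if t \<le> d then Chain (d - t) else BEnd))"

lemma normal_not_Final: "normal m t i \<noteq> Dead \<and> normal m t i \<notin> range Final"
  by (auto simp: normal_def column_def)

lemma normal_step: "trans (normal m t i) (emit (normal m t (Suc i))) = normal m (Suc t) i"
proof -
  consider "m \<le> i" | "Suc i = m" "t = 0" | "Suc i < m" "t = 0" | "i < m" "0 < t" by linarith
  thus ?thesis
  proof cases
    case 1
    \<comment> \<open>All \<open>b\<close>-cells count in step, so the neighbour sends what the cell
      itself would send. At time \<open>d\<close> they all send the initial message, which only
      column 0 uses.\<close>
    hence e: "normal m t (Suc i) = normal m t i" by (simp add: normal_def)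
    have "trans (normal m t i) x = normal m (Suc t) i" if "x \<noteq> Some MsgEnd" "t < d \<Longrightarrow> x = None" for x
    proof -
      consider "t < d" | "t = d" | "d < t" by linarith
      thus ?thesis
      proof cases
        case 1
        then obtain k where "d - t = Suc k" "d - Suc t = k" by (metis Suc_diff_Suc)
        thus ?thesis using 1 \<open>m \<le> i\<close> that by (auto simp: normal_def trans_def)
      qed (use \<open>m \<le> i\<close> that in \<open>auto simp: normal_def trans_def\<close>)
    qed
    moreover have "emit (normal m t i) = signal (arriving 0 t) (incoming 0 t)"
      using 1 emit_chain by (simp add: normal_def)
    ultimately show ?thesis using rho_0
      by (simp add: e signal_def arriving_def incoming_def)
  next
    case 2
    moreover have "emit (Chain d) = None" using d_pos by (cases d) auto
    ultimately show ?thesis using column_first by (auto simp: normal_def)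
  next
    case 3
    thus ?thesis using column_later[of "m - Suc i"] by (simp add: normal_def)
  next
    case 4
    have "emit (normal m t (Suc i)) = signal (arriving (m - 1 - i) t) (incoming (m - 1 - i) t)"
    proof (cases "Suc i < m")
      case True
      hence "m - 1 - i = Suc (m - 1 - Suc i)" by simp
      thus ?thesis using True 4 emit_column[of "m - 1 - Suc i" t] by (simp add: normal_def)
    next
      case False
      hence "m - 1 - i = 0" by simp
      thus ?thesis using False emit_chain by (simp add: normal_def)
    qed
    thus ?thesis using 4 column_step[OF 4(2)]
      by (simp add: normal_def column_def trans_col_signal)
  qed
qed

abbreviation word :: "nat \<Rightarrow> nat \<Rightarrow> 'q cell list" where
  "word m n \<equiv> replicate m LetterA @ replicate n (Chain d)"

text \<open>The end marker acts at a speed of one cell per step and reaches cell \<open>i\<close> at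
  time \<open>m + n - i\<close>. Ahead of this wave nothing differs from the infinite block, and
  behind it all cells are dead.\<close>

lemma aconf_word:
  "i < m + n \<Longrightarrow> aconf (word m n) t ! i = (if t + i < m + n then normal m t i
     else if t + i = m + n then Final (good (normal m (t - 1) i)) else Dead)"
proof (induction t arbitrary: i)
  case 0
  thus ?case by (auto simp: normal_def nth_append)
next
  case (Suc t)
  let ?x = "if Suc i = m + n then (if t = 0 then Some MsgEnd else None) else emit (aconf (word m n) t ! Suc i)"
  have s: "aconf (word m n) (Suc t) ! i = trans (aconf (word m n) t ! i) ?x"
    using aconf_Suc_nth[of i "word m n" t] Suc.prems by simp
  consider "Suc t + i < m + n" | "Suc t + i = m + n" | "m + n \<le> t + i" by linarith
  thus ?case
  proof cases
    case 1
    thus ?thesis using s Suc.IH[of i] Suc.IH[of "Suc i"] normal_step by simp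
  next
    case 2
    have "?x = Some MsgEnd" using 2 Suc.IH[of "Suc i"] by auto
    thus ?thesis using 2 s Suc.IH[OF Suc.prems] normal_not_Final[of m t i] by (simp add: trans_def)
  next
    case 3
    thus ?thesis using s Suc.IH[OF Suc.prems] by (auto simp: trans_def)
  qed
qed

text \<open>The leftmost cell is column \<open>us k\<close>, which leg \<open>k\<close> reaches at
  time \<open>us k + rho k\<close>. Its last ordinary state is that of time
  \<open>m + n - 1 = us k + n\<close>, hence the condition \<open>rho k < n\<close>.\<close>

definition hits :: "nat \<Rightarrow> nat \<Rightarrow> bool" where
  "hits m n \<longleftrightarrow> (\<exists>k. m = Suc (us k) \<and> rho k < n \<and> kap (Suc k) \<in> F)"

lemma good_normal:
  assumes "0 < m + n"
  shows "good (normal m (m + n - 1) 0) \<longleftrightarrow> hits m n = pol"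
proof -
  have "(\<exists>ts q fw. normal m (m + n - 1) 0 = Col ts (Some q) fw \<and> q \<in> F) \<longleftrightarrow> hits m n"
  proof (cases "m = 0 \<or> m + n - 1 = 0")
    case True
    thus ?thesis using assms by (auto simp: normal_def hits_def)
  next
    case False
    let ?u = "m - 1"
    have "(\<exists>ts q fw. normal m (m + n - 1) 0 = Col ts (Some q) fw \<and> q \<in> F) \<longleftrightarrow>
       0 < leg ?u \<and> us (leg ?u - 1) = ?u \<and> ?u + rho (leg ?u - 1) < m + n - 1 \<and> kap (leg ?u) \<in> F"
      using False by (auto simp: normal_def column_def mark_def)
    also have "\<dots> \<longleftrightarrow> hits m n"
    proof
      assume *: "0 < leg ?u \<and> us (leg ?u - 1) = ?u \<and> ?u + rho (leg ?u - 1) < m + n - 1 \<and> kap (leg ?u) \<in> F"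
      thus "hits m n" unfolding hits_def using False
        by (intro exI[of _ "leg ?u - 1"]) (auto simp: less_diff_conv)
    next
      assume "hits m n"
      then obtain k where k: "m = Suc (us k)" "rho k < n" "kap (Suc k) \<in> F" by (auto simp: hits_def)
      thus "0 < leg ?u \<and> us (leg ?u - 1) = ?u \<and> ?u + rho (leg ?u - 1) < m + n - 1 \<and> kap (leg ?u) \<in> F"
        by (simp add: leg_us)
    qed
    finally show ?thesis .
  qed
  thus ?thesis by (simp add: good_def)
qed

lemma word_accepted:
  assumes "0 < m + n"
  shows "(\<exists>t. 1 \<le> t \<and> t \<le> m + n \<and> hd (aconf (word m n) t) = Final True) \<longleftrightarrow> hits m n = pol"
proof -
  have hd: "hd (aconf (word m n) t) = aconf (word m n) t ! 0" for t
    using assms by (intro hd_conv_nth) (metis length_aconf length_append length_replicate length_greater_0_conv)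
  have "hd (aconf (word m n) t) = Final True \<longleftrightarrow> t = m + n \<and> hits m n = pol" if "t \<le> m + n" for t
    using that assms aconf_word[of 0 m n t] good_normal[OF assms] normal_not_Final[of m t 0]
    by (auto simp: hd)
  thus ?thesis using assms by (metis One_nat_def Suc_leI order_refl)
qed

lemma card_emissions:
  assumes "p < m + n"
  shows "card {j. j < m + n \<and> emit (aconf (word m n) j ! p) \<noteq> None} \<le> nr + 4"
proof -
  let ?u = "m - 1 - p"
  \<comment> \<open>The possible sending times: 0 for \<open>MsgA\<close>, \<open>d\<close> for the
    countdown, \<open>m + n - p\<close> for the end wave, one time for the message on its way to the
    next column, and one time for handing on each ray.\<close>
  let ?S = "{0, d, m + n - p, Suc (?u + rho (leg ?u))} \<union> (\<lambda>r. Suc (?u + slope r * Suc ?u)) ` {..<nr}"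
  have "{j. j < m + n \<and> emit (aconf (word m n) j ! p) \<noteq> None} \<subseteq> ?S"
  proof
    fix j assume "j \<in> {j. j < m + n \<and> emit (aconf (word m n) j ! p) \<noteq> None}"
    hence j: "emit (aconf (word m n) j ! p) \<noteq> None" by simp
    consider "j + p = m + n" | "j + p < m + n" using j aconf_word[OF assms, of j] by fastforce
    thus "j \<in> ?S"
    proof cases
      case 1
      hence "j = m + n - p" by simp
      thus ?thesis by blast
    next
      case 2
      hence e: "emit (normal m j p) \<noteq> None" using j aconf_word[OF assms, of j] by simp
      show ?thesis
      proof (cases "p < m")
        case True
        have "j = 0 \<or> signal (arriving (Suc ?u) j) (incoming (Suc ?u) j) \<noteq> None"
          using e True emit_column[of ?u j] by (auto simp: normal_def)
        thus ?thesis
          by (auto simp: signal_def arriving_def incoming_def split: if_splits)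
      next
        case False
        hence "signal (arriving 0 j) (incoming 0 j) \<noteq> None"
          using e emit_chain by (simp add: normal_def)
        thus ?thesis using rho_0
          by (auto simp: signal_def arriving_def incoming_def split: if_splits)
      qed
    qed
  qed
  hence "card {j. j < m + n \<and> emit (aconf (word m n) j ! p) \<noteq> None} \<le> card ?S"
    by (intro card_mono) auto
  also have "\<dots> \<le> card {0, d, m + n - p, Suc (?u + rho (leg ?u))} + card ((\<lambda>r. Suc (?u + slope r * Suc ?u)) ` {..<nr})"
    by (rule card_Un_le)
  also have "\<dots> \<le> 4 + nr"
    using card_image_le[of "{..<nr}" "\<lambda>r. Suc (?u + slope r * Suc ?u)"]
    by (intro add_mono) (auto intro: order_trans[OF card_insert_le_m1] simp: card_insert_if)
  finally show ?thesis by simp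
qed

end

section \<open>Numbering of cells and messages\<close>

lemma concat_rows:
  "0 < W \<Longrightarrow> map (\<lambda>z. f (z div W) (z mod W)) [0..<n * W] = concat (map (\<lambda>s. map (f s) [0..<W]) [0..<n])"
proof (induction n)
  case (Suc n)
  have "[0..<Suc n * W] = [0..<n * W] @ [n * W..<n * W + W]"
    using upt_add_eq_append[of 0 "n * W" W] by (simp add: add.commute)
  moreover have "map (\<lambda>z. f (z div W) (z mod W)) [n * W..<n * W + W] = map (f n) [0..<W]"
    using Suc.prems by (intro nth_equalityI) auto
  ultimately show ?case using Suc by simp
qed simp

lemma finite_partial: "finite A \<Longrightarrow> finite {x. x = None \<or> (\<exists>q\<in>A. x = Some q)}"
  by (rule finite_subset[of _ "insert None (Some ` A)"]) auto

section \<open>Finite sets of cells and messages\<close>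

context ray_oca
begin

definition controls :: "'q option set" where "controls = {x. x = None \<or> (\<exists>q\<in>C. x = Some q)}"

text \<open>The sum of the slopes serves as a common bound for all timers. With the countdown cells
  kept apart, this set and its numbering do not depend on the countdown length.\<close>

definition fixed_cells :: "'q cell set" where
  "fixed_cells = {LetterA, Dead, BEnd, Final True, Final False} \<union>
     {Col ts mk fw | ts mk fw. length ts = nr \<and> set ts \<subseteq> {..(\<Sum>j<nr. slope j) + 2} \<and> mk \<in> controls \<and> fw \<in> controls}"

definition messages :: "'q message set" where
  "messages = {MsgA, MsgEnd} \<union> {Signal E h | E h. E \<subseteq> {..<nr} \<and> h \<in> controls}"

definition cells :: "nat \<Rightarrow> 'q cell set" where "cells d = fixed_cells \<union> Chain ` {..d}"

definition inputs :: "'q message option set" where "inputs = insert None (Some ` messages)"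

lemma finite_controls: "finite controls"
  unfolding controls_def using finite_C by (rule finite_partial)

lemma finite_fixed_cells: "finite fixed_cells"
proof -
  have "{Col ts mk fw | ts mk fw. length ts = nr \<and> set ts \<subseteq> {..(\<Sum>j<nr. slope j) + 2} \<and> mk \<in> controls \<and> fw \<in> controls}
    = (\<lambda>(ts, mk, fw). Col ts mk fw) ` ({ts. set ts \<subseteq> {..(\<Sum>j<nr. slope j) + 2} \<and> length ts = nr} \<times> controls \<times> controls)"
    by (auto simp: image_iff)
  thus ?thesis unfolding fixed_cells_def
    using finite_lists_length_eq[of "{..(\<Sum>j<nr. slope j) + 2}" nr] finite_controls by simp
qed

lemma finite_messages: "finite messages"
proof -
  have "{Signal E h | E h. E \<subseteq> {..<nr} \<and> h \<in> controls} = (\<lambda>(E, h). Signal E h) ` (Pow {..<nr} \<times> controls)"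
    by (auto simp: image_iff)
  thus ?thesis unfolding messages_def using finite_controls by simp
qed

lemma emit_inputs: "s \<in> cells d \<Longrightarrow> emit s \<in> inputs"
  by (cases s rule: emit.cases)
    (auto simp: inputs_def messages_def signal_def cells_def fixed_cells_def controls_def q0)

lemma col_step_cells:
  assumes s: "length ts = nr" "set ts \<subseteq> {..(\<Sum>j<nr. slope j) + 2}" "mk \<in> controls" and h: "h \<in> controls"
  shows "col_step ts mk E h \<in> fixed_cells"
proof -
  have sl: "slope j + 2 \<le> (\<Sum>j<nr. slope j) + 2" if "j < nr" for j
    using that by (simp add: member_le_sum)
  define ts' where "ts' = map (\<lambda>j. if j \<in> E then 1 else if ts ! j = 0 then 0 else min (Suc (ts ! j)) (slope j + 2)) [0..<nr]"
  have ts': "length ts' = nr" "set ts' \<subseteq> {..(\<Sum>j<nr. slope j) + 2}"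
    unfolding ts'_def using sl by (auto simp: min_le_iff_disj)
  have "Col ts' mk' fw' \<in> fixed_cells" if "mk' \<in> controls" "fw' \<in> controls" for mk' fw'
    using ts' that by (auto simp: fixed_cells_def)
  moreover have "None \<in> controls" by (simp add: controls_def)
  moreover have "Some q' \<in> controls" if "h = Some q" "stop q E' = Some q'" for q q' E'
    using that h stop_closed by (auto simp: controls_def)
  ultimately show ?thesis unfolding col_step_def Let_def ts'_def[symmetric]
    using s h by (auto split: option.splits)
qed

lemma end_inputs: "None \<in> inputs" "Some MsgEnd \<in> inputs"
  by (auto simp: inputs_def messages_def)

lemma Col_cells: "Col ts mk fw \<in> cells d \<longleftrightarrow>
    length ts = nr \<and> set ts \<subseteq> {..(\<Sum>j<nr. slope j) + 2} \<and> mk \<in> controls \<and> fw \<in> controls"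
  by (auto simp: cells_def fixed_cells_def)

lemma letters: "LetterA \<in> cells d" "Chain d \<in> cells d" "Final b \<in> cells d"
  by (cases b) (auto simp: cells_def fixed_cells_def)

lemma other_cells: "Dead \<in> cells d" "BEnd \<in> cells d" "Chain i \<in> cells d \<longleftrightarrow> i \<le> d"
  by (auto simp: cells_def fixed_cells_def)

lemma trans_inner_cells:
  assumes s: "s \<in> cells d" and x: "x \<in> inputs"
  shows "trans_inner s x \<in> cells d"
proof -
  have N: "None \<in> controls" by (simp add: controls_def)
  have step: "col_step ts mk E h \<in> cells d" if "Col ts mk fw \<in> cells d" "h \<in> controls" for ts mk fw E h
    using col_step_cells that by (simp add: Col_cells) (simp add: cells_def)
  have E: "h \<in> controls" if "Some (Signal E h) \<in> inputs" for E h
    using that by (auto simp: inputs_def messages_def)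
  have rep: "Col (replicate nr k) None None \<in> cells d" if "k \<le> 1" for k
    using that N by (auto simp: Col_cells)
  show ?thesis
    using s x by (cases "(s, x)" rule: trans_inner.cases)
      (simp_all add: other_cells rep N step E)
qed

lemma trans_cells: "s \<in> cells d \<Longrightarrow> x \<in> inputs \<Longrightarrow> trans s x \<in> cells d"
  unfolding trans_def using trans_inner_cells letters(3) other_cells(1) by simp

definition cell_count :: nat where "cell_count = card fixed_cells"
definition cell_no :: "'q cell \<Rightarrow> nat" where "cell_no = (SOME f. bij_betw f fixed_cells {0..<cell_count})"
definition message_count :: nat where "message_count = card messages"
definition message_no :: "'q message \<Rightarrow> nat" where "message_no = (SOME f. bij_betw f messages {0..<message_count})"

lemma cell_no: "bij_betw cell_no fixed_cells {0..<cell_count}"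
  unfolding cell_no_def cell_count_def
  using ex_bij_betw_finite_nat[OF finite_fixed_cells] by (rule someI_ex)

lemma message_no: "bij_betw message_no messages {0..<message_count}"
  unfolding message_no_def message_count_def
  using ex_bij_betw_finite_nat[OF finite_messages] by (rule someI_ex)

lemma cell_no_less: "s \<in> fixed_cells \<Longrightarrow> cell_no s < cell_count"
  using bij_betw_apply[OF cell_no] by simp

lemma message_no_less: "x \<in> messages \<Longrightarrow> message_no x < message_count"
  using bij_betw_apply[OF message_no] by simp

text \<open>Countdown cells are numbered in order after all others, so that a longer countdown
  merely appends states.\<close>

definition enc :: "'q cell \<Rightarrow> nat" where
  "enc s = (case s of Chain i \<Rightarrow> cell_count + i | _ \<Rightarrow> cell_no s)"

definition dec :: "nat \<Rightarrow> 'q cell" where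
  "dec s = (if s < cell_count then inv_into fixed_cells cell_no s else Chain (s - cell_count))"

lemma Chain_not_fixed: "Chain i \<notin> fixed_cells"
  by (auto simp: fixed_cells_def)

lemma enc_fixed: "s \<in> fixed_cells \<Longrightarrow> enc s = cell_no s"
  by (auto simp: enc_def Chain_not_fixed split: cell.splits)

lemma dec_enc: "s \<in> cells d \<Longrightarrow> dec (enc s) = s"
proof -
  assume "s \<in> cells d"
  then consider "s \<in> fixed_cells" | i where "s = Chain i" by (auto simp: cells_def)
  thus ?thesis
  proof cases
    case 1
    thus ?thesis using cell_no by (auto simp: enc_fixed dec_def bij_betw_def)
  qed (simp add: enc_def dec_def)
qed

lemma enc_less: "s \<in> cells d \<Longrightarrow> enc s < Suc (cell_count + d)"
proof -
  assume "s \<in> cells d"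
  then consider "s \<in> fixed_cells" | i where "s = Chain i" "i \<le> d" by (auto simp: cells_def)
  thus ?thesis
  proof cases
    case 1
    thus ?thesis using cell_no_less[of s] by (simp add: enc_fixed)
  qed (simp add: enc_def)
qed

lemma dec_cells: "s < Suc (cell_count + d) \<Longrightarrow> dec s \<in> cells d"
  using cell_no by (auto simp: dec_def cells_def bij_betw_def intro: inv_into_into)

lemma enc_eq_iff: "s \<in> cells d \<Longrightarrow> s' \<in> cells d \<Longrightarrow> enc s = enc s' \<longleftrightarrow> s = s'"
  using dec_enc by metis

definition input_of :: "nat \<Rightarrow> 'q message option" where
  "input_of r = (case r of 0 \<Rightarrow> None | Suc 0 \<Rightarrow> Some MsgEnd | Suc (Suc k) \<Rightarrow> Some (inv_into messages message_no k))"

definition emit_code :: "nat \<Rightarrow> nat" where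
  "emit_code s = (case emit (dec s) of None \<Rightarrow> 0 | Some x \<Rightarrow> Suc (message_no x))"

definition trans_code :: "nat \<Rightarrow> nat \<Rightarrow> nat" where
  "trans_code s r = enc (trans (dec s) (input_of r))"

definition the_oca :: "nat \<Rightarrow> oca" where
  "the_oca d = OCA (Suc (cell_count + d)) [enc (Final True)] [enc LetterA, enc (Chain d)] message_count
     (map emit_code [0..<Suc (cell_count + d)])
     (map (\<lambda>z. trans_code (z div (message_count + 2)) (z mod (message_count + 2)))
       [0..<Suc (cell_count + d) * (message_count + 2)])"

lemma the_oca_sel [simp]:
  "st_num (the_oca d) = Suc (cell_count + d)" "acc_list (the_oca d) = [enc (Final True)]"
  "inp_list (the_oca d) = [enc LetterA, enc (Chain d)]" "msg_num (the_oca d) = message_count"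
  by (simp_all add: the_oca_def)

lemma letters_neq: "enc LetterA \<noteq> enc (Chain d)"
  using enc_eq_iff[OF letters(1,2)] by simp

lemma input_of_inputs: "r < message_count + 2 \<Longrightarrow> input_of r \<in> inputs"
proof -
  have "inv_into messages message_no k \<in> messages" if "k < message_count" for k
    using that message_no by (intro inv_into_into) (simp add: bij_betw_def)
  moreover have "MsgEnd \<in> messages" by (simp add: messages_def)
  ultimately show "r < message_count + 2 \<Longrightarrow> input_of r \<in> inputs"
    by (auto simp: input_of_def inputs_def split: nat.split)
qed

lemma emit_code_le: "s < Suc (cell_count + d) \<Longrightarrow> emit_code s \<le> message_count"
  using emit_inputs[OF dec_cells[of s d]]
  by (auto simp: emit_code_def inputs_def split: option.splits intro!: Suc_leI message_no_less)

lemma oca_wf_the_oca: "oca_wf (the_oca d)"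
proof -
  have "trans_code (z div (message_count + 2)) (z mod (message_count + 2)) < Suc (cell_count + d)"
    if "z < Suc (cell_count + d) * (message_count + 2)" for z
    unfolding trans_code_def
    by (intro enc_less trans_cells dec_cells input_of_inputs)
      (use that in \<open>auto simp: less_mult_imp_div_less\<close>)
  thus ?thesis unfolding oca_wf_def
    using emit_code_le[of _ d] letters_neq enc_less[OF letters(1)] enc_less[OF letters(2)] enc_less[OF letters(3)]
    by (auto simp: the_oca_def)
qed

lemma oca_delta_the_oca:
  "s < Suc (cell_count + d) \<Longrightarrow> r < message_count + 2 \<Longrightarrow> oca_delta (the_oca d) s r = trans_code s r"
proof -
  assume *: "s < Suc (cell_count + d)" "r < message_count + 2"
  have "s * (message_count + 2) + r < Suc (cell_count + d) * (message_count + 2)"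
  proof -
    have "s * (message_count + 2) + r < Suc s * (message_count + 2)" using *(2) by simp
    also have "\<dots> \<le> Suc (cell_count + d) * (message_count + 2)" using *(1) by (intro mult_le_mono1) simp
    finally show ?thesis .
  qed
  moreover have "(s * (message_count + 2) + r) div (message_count + 2) = s"
    "(s * (message_count + 2) + r) mod (message_count + 2) = r"
    using *(2) by (simp_all only: div_mult_self3 mod_mult_self3 div_less mod_less)
  ultimately show ?thesis
    unfolding oca_delta_def the_oca_sel by (simp add: the_oca_def del: mult_Suc upt_Suc)
qed

lemma bl_tab_the_oca: "s \<in> cells d \<Longrightarrow> bl_tab (the_oca d) ! enc s = (case emit s of None \<Rightarrow> 0 | Some x \<Rightarrow> Suc (message_no x))"
  using enc_less[of s d] dec_enc[of s d] by (simp add: the_oca_def emit_code_def del: upt_Suc)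

lemma bl_in_the_oca:
  assumes "s \<in> cells d"
  shows "bl_in (the_oca d) (enc s) < message_count + 2" "input_of (bl_in (the_oca d) (enc s)) = emit s"
  using bl_tab_the_oca[OF assms] emit_inputs[OF assms] message_no message_no_less
  by (auto simp: bl_in_def input_of_def inputs_def bij_betw_def split: option.splits)

lemma conf_the_oca:
  assumes w: "set w \<subseteq> cells d"
  shows "conf (the_oca d) (map enc w) t = map enc (aconf w t) \<and> set (aconf w t) \<subseteq> cells d"
proof (induction t)
  case (Suc t)
  have nth: "aconf w t ! i \<in> cells d" if "i < length w" for i
    using that Suc by (metis length_aconf nth_mem subsetD)
  define x where "x i = (if Suc i = length w then (if t = 0 then Some MsgEnd else None) else emit (aconf w t ! Suc i))" for i
  have x: "x i \<in> inputs" if "i < length w" for i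
    using that emit_inputs[OF nth[of "Suc i"]] by (auto simp: x_def end_inputs)
  have s: "aconf w (Suc t) = map (\<lambda>i. trans (aconf w t ! i) (x i)) [0..<length w]"
    by (simp add: Let_def x_def)
  have r: "(if Suc i = length w then (if t = 0 then 1 else 0) else bl_in (the_oca d) (map enc (aconf w t) ! Suc i)) < message_count + 2
    \<and> input_of (if Suc i = length w then (if t = 0 then 1 else 0) else bl_in (the_oca d) (map enc (aconf w t) ! Suc i)) = x i"
    if "i < length w" for i
    using that bl_in_the_oca[OF nth[of "Suc i"]] by (auto simp: x_def input_of_def)
  have "conf (the_oca d) (map enc w) (Suc t) = map enc (aconf w (Suc t))"
    unfolding conf.simps s
    using Suc r nth by (auto simp: Let_def oca_delta_the_oca enc_less trans_code_def dec_enc[where d = d] simp del: aconf.simps)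
  moreover have "set (aconf w (Suc t)) \<subseteq> cells d"
    unfolding s using nth x trans_cells by auto
  ultimately show ?case ..
qed (use w in auto)

lemma rt_lang_the_oca:
  "rt_lang (the_oca d) = map enc ` {w. w \<noteq> [] \<and> set w \<subseteq> {LetterA, Chain d} \<and>
     (\<exists>t. 1 \<le> t \<and> t \<le> length w \<and> hd (aconf w t) = Final True)}" (is "_ = map enc ` ?A")
proof -
  have acc: "(hd (conf (the_oca d) (map enc w) t) \<in> set (acc_list (the_oca d))) \<longleftrightarrow> hd (aconf w t) = Final True"
    if "w \<noteq> []" "set w \<subseteq> {LetterA, Chain d}" for w t
  proof -
    have w: "set w \<subseteq> cells d" using that letters by auto
    have ne: "aconf w t \<noteq> []" using that(1) by (metis length_aconf length_0_conv)
    hence "hd (aconf w t) \<in> cells d" using conf_the_oca[OF w, of t] hd_in_set by blast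
    thus ?thesis using conf_the_oca[OF w, of t] ne enc_eq_iff letters(3) by (simp add: hd_map)
  qed
  show ?thesis
  proof (intro subset_antisym subsetI)
    fix v assume v: "v \<in> rt_lang (the_oca d)"
    hence "set v \<subseteq> enc ` {LetterA, Chain d}" by (simp add: rt_lang_def)
    hence "v \<in> map enc ` lists {LetterA, Chain d}" unfolding lists_image[symmetric] by auto
    then obtain w where w: "v = map enc w" "set w \<subseteq> {LetterA, Chain d}" by (auto simp: lists_eq_set)
    have "w \<in> ?A" using v w acc[OF _ w(2)] by (auto simp: rt_lang_def)
    thus "v \<in> map enc ` ?A" using w by blast
  next
    fix v assume "v \<in> map enc ` ?A"
    then obtain w where w: "v = map enc w" "w \<in> ?A" by blast
    thus "v \<in> rt_lang (the_oca d)" using acc[of w] by (auto simp: rt_lang_def)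
  qed
qed

lemma com_the_oca:
  assumes w: "set w \<subseteq> cells d" and i: "Suc i < length w"
  shows "com (the_oca d) (map enc w) i t = card {j. j < t \<and> emit (aconf w j ! Suc i) \<noteq> None}"
proof -
  have "bl_tab (the_oca d) ! (conf (the_oca d) (map enc w) j ! Suc i) \<noteq> 0 \<longleftrightarrow> emit (aconf w j ! Suc i) \<noteq> None" for j
  proof -
    have "aconf w j ! Suc i \<in> cells d" using conf_the_oca[OF w, of j] i by (metis length_aconf nth_mem subsetD)
    from bl_tab_the_oca[OF this] show ?thesis using conf_the_oca[OF w, of j] i by (auto split: option.splits)
  qed
  thus ?thesis by (simp add: com_def)
qed

lemma two_letter_word:
  "set w \<subseteq> {x, y} \<Longrightarrow> x \<noteq> y \<Longrightarrow> (\<exists>m n. w = replicate m x @ replicate n y) \<or> (\<exists>i. Suc i < length w \<and> w ! i = y \<and> w ! Suc i = x)"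
proof (induction w)
  case (Cons c w)
  from Cons consider m n where "w = replicate m x @ replicate n y" | i where "Suc i < length w" "w ! i = y" "w ! Suc i = x"
    by auto
  thus ?case
  proof cases
    case 1
    show ?thesis
    proof (cases "c = x")
      case True
      thus ?thesis using 1 by (intro disjI1 exI[of _ "Suc m"] exI[of _ n]) simp
    next
      case False
      hence c: "c = y" using Cons.prems by auto
      show ?thesis
      proof (cases m)
        case 0
        thus ?thesis using 1 c by (intro disjI1 exI[of _ 0] exI[of _ "Suc n"]) simp
      next
        case (Suc k)
        thus ?thesis using 1 c by (intro disjI2 exI[of _ 0]) simp
      qed
    qed
  next
    case 2
    thus ?thesis by (intro disjI2 exI[of _ "Suc i"]) simp
  qed
qed simp

text \<open>The last of these rows is that of \<open>Chain 0\<close>, numbered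
  \<open>cell_count\<close>, which unlike the other countdown cells does not count further.\<close>

definition fixed_rows :: "nat list" where
  "fixed_rows = concat (map (\<lambda>s. map (trans_code s) [0..<message_count + 2]) [0..<Suc cell_count])"

definition chain_rest :: "nat list" where
  "chain_rest = map (trans_code (Suc cell_count)) [1..<message_count + 2]"

lemma bl_tab_the_oca_append:
  "bl_tab (the_oca d) = map emit_code [0..<Suc cell_count] @ replicate d 0"
proof -
  have "[0..<Suc (cell_count + d)] = [0..<Suc cell_count] @ [Suc cell_count..<Suc cell_count + d]"
    using upt_add_eq_append[of 0 "Suc cell_count" d] by simp
  moreover have "map emit_code [Suc cell_count..<Suc cell_count + d] = replicate d 0"
  proof (rule nth_equalityI)
    fix i assume "i < length (map emit_code [Suc cell_count..<Suc cell_count + d])"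
    moreover have "dec (Suc (cell_count + i)) = Chain (Suc i)" by (simp add: dec_def)
    ultimately show "map emit_code [Suc cell_count..<Suc cell_count + d] ! i = replicate d 0 ! i"
      by (simp add: emit_code_def del: upt_Suc)
  qed simp
  ultimately show ?thesis by (simp add: the_oca_def del: upt_Suc)
qed

text \<open>All cells \<open>Chain (Suc i)\<close> react alike to every message, by dying or joining
  the end wave. Only the entry for silence depends on \<open>i\<close>, so the row of
  \<open>Chain 1\<close> provides the rest of all these rows.\<close>

lemma delta_tab_the_oca_append:
  "delta_tab (the_oca d) = fixed_rows @ countdown_rows chain_rest (Suc cell_count) d"
proof -
  let ?W = "message_count + 2"
  have up: "[0..<Suc (cell_count + d)] = [0..<Suc cell_count] @ [Suc cell_count..<Suc cell_count + d]"
    using upt_add_eq_append[of 0 "Suc cell_count" d] by simp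
  have W: "[0..<?W] = 0 # [1..<?W]" by (subst upt_conv_Cons) auto
  have "map (trans_code s) [0..<?W] = (s - 1) # chain_rest" if "Suc cell_count \<le> s" for s
  proof -
    from that obtain i where i: "s = cell_count + Suc i" by (metis add_Suc_right add_Suc le_Suc_ex)
    have dec: "dec s = Chain (Suc i)" "dec (Suc cell_count) = Chain (Suc 0)" using i by (auto simp: dec_def)
    have "input_of 0 = None" by (simp add: input_of_def)
    hence "trans_code s 0 = s - 1" unfolding trans_code_def dec using i by (auto simp: trans_def enc_def)
    moreover have "trans_code s r = trans_code (Suc cell_count) r" if "1 \<le> r" for r
    proof -
      obtain y where y: "input_of r = Some y"
        using \<open>1 \<le> r\<close> by (cases r; cases "r - 1") (auto simp: input_of_def)
      have "good (Chain (Suc i)) = good (Chain (Suc 0))" by (simp add: good_def)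
      thus ?thesis unfolding trans_code_def dec y by (auto simp: trans_def)
    qed
    ultimately show ?thesis unfolding W chain_rest_def by (auto simp del: upt_Suc)
  qed
  hence rows: "map (\<lambda>s. map (trans_code s) [0..<?W]) [Suc cell_count..<Suc cell_count + d]
     = map (\<lambda>s. (s - 1) # chain_rest) [Suc cell_count..<Suc cell_count + d]" by (intro map_cong) auto
  have "delta_tab (the_oca d) = concat (map (\<lambda>s. map (trans_code s) [0..<?W]) [0..<Suc (cell_count + d)])"
    unfolding the_oca_def oca.sel by (rule concat_rows) simp
  thus ?thesis
    unfolding up fixed_rows_def countdown_rows_def map_append rows concat_append .
qed

end

section \<open>The accepted language and the communication bounds\<close>

context ray_orbit
begin

lemma set_word: "set (word m n) \<subseteq> {LetterA, Chain d}"
  by auto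

lemma rt_lang_the_oca_words:
  "rt_lang (the_oca d) = {replicate m (enc LetterA) @ replicate n (enc (Chain d)) | m n. 0 < m + n \<and> hits m n = pol}"
  (is "_ = ?B")
proof -
  have "{w. w \<noteq> [] \<and> set w \<subseteq> {LetterA, Chain d} \<and> (\<exists>t. 1 \<le> t \<and> t \<le> length w \<and> hd (aconf w t) = Final True)}
    = {word m n | m n. 0 < m + n \<and> hits m n = pol}" (is "?A = _")
  proof (intro subset_antisym subsetI)
    fix w assume "w \<in> ?A"
    then obtain t where w: "w \<noteq> []" "set w \<subseteq> {LetterA, Chain d}" and t: "1 \<le> t" "t \<le> length w" "hd (aconf w t) = Final True"
      by blast
    have "\<not> (\<exists>i. Suc i < length w \<and> w ! i = Chain d \<and> w ! Suc i = LetterA)"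
    proof
      assume "\<exists>i. Suc i < length w \<and> w ! i = Chain d \<and> w ! Suc i = LetterA"
      then obtain i where i: "Suc i < length w" "w ! i = Chain d" "w ! Suc i = LetterA" by blast
      obtain k where k: "d = Suc k" using d_pos by (cases d) auto
      have "w ! p \<notin> range Final" if "p \<le> i" for p
      proof -
        have "w ! p \<in> set w" using that i by simp
        thus ?thesis using w(2) by auto
      qed
      hence "aconf w t ! 0 \<notin> range Final"
        using descent_not_Final[of i w k t] i k by blast
      thus False using t(3) w(1) by (metis hd_conv_nth length_0_conv length_aconf rangeI)
    qed
    then obtain m n where mn: "w = word m n" using two_letter_word[OF w(2)] by auto
    hence pos: "0 < m + n" using w(1) by auto
    moreover have "hits m n = pol" using word_accepted[OF pos] t mn by auto
    ultimately show "w \<in> {word m n | m n. 0 < m + n \<and> hits m n = pol}" using mn by blast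
  next
    fix w assume "w \<in> {word m n | m n. 0 < m + n \<and> hits m n = pol}"
    then obtain m n where mn: "w = word m n" "0 < m + n" "hits m n = pol" by blast
    thus "w \<in> ?A" using word_accepted[of m n] set_word[of m n] by auto
  qed
  moreover have "map enc ` {word m n | m n. 0 < m + n \<and> hits m n = pol} = ?B"
  proof (intro subset_antisym subsetI)
    fix v assume "v \<in> map enc ` {word m n | m n. 0 < m + n \<and> hits m n = pol}"
    then obtain m n where "v = map enc (word m n)" "0 < m + n" "hits m n = pol" by blast
    thus "v \<in> ?B" by simp blast
  next
    fix v assume "v \<in> ?B"
    then obtain m n where "v = map enc (word m n)" "0 < m + n" "hits m n = pol" by auto
    thus "v \<in> map enc ` {word m n | m n. 0 < m + n \<and> hits m n = pol}" by blast
  qed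
  ultimately show ?thesis using rt_lang_the_oca by simp
qed

lemma com_bound:
  assumes "v \<in> rt_lang (the_oca d)" "Suc i < length v"
  shows "com (the_oca d) v i (length v) \<le> nr + 4"
proof -
  obtain m n where v: "v = map enc (word m n)" using assms(1) rt_lang_the_oca_words by fastforce
  have "set (word m n) \<subseteq> cells d" using set_word letters by blast
  from com_the_oca[OF this, of i "m + n"] card_emissions[of "Suc i" m n] show ?thesis
    using assms(2) v by simp
qed

lemma SC_the_oca: "SC_OCA_n (the_oca d)"
  unfolding SC_OCA_n_def
proof (intro exI[of _ "\<lambda>n. real (nr + 4) * real n"] conjI ballI)
  fix v assume v: "v \<in> rt_lang (the_oca d)"
  have "scom (the_oca d) v \<le> (\<Sum>i<length v - 1. nr + 4)"
    unfolding scom_def by (rule sum_mono) (use com_bound[OF v] in auto)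
  also have "\<dots> \<le> (nr + 4) * length v" by simp
  finally show "real (scom (the_oca d) v) \<le> real (nr + 4) * real (length v)"
    by (metis of_nat_le_iff of_nat_mult)
qed simp

lemma MC_the_oca: "MC_OCA_log (the_oca d)"
  unfolding MC_OCA_log_def
proof (intro exI[of _ "\<lambda>n. real (nr + 4)"] conjI ballI)
  show "(\<lambda>n. real (nr + 4)) \<in> O(\<lambda>n. ln (real n))"
  proof (rule bigoI)
    \<comment> \<open>\<open>ln\<close> vanishes at 1; from 3 on it is at least 1, as
      \<open>exp 1\<close> is at most 3, and so dominates the constant bound.\<close>
    have "1 \<le> ln (real n)" if "3 \<le> n" for n
    proof -
      have "exp 1 \<le> real n" using exp_le that by linarith
      thus ?thesis using that by (subst ln_ge_iff) auto
    qed
    hence "norm (real (nr + 4)) \<le> real (nr + 4) * norm (ln (real n))" if "3 \<le> n" for n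
      using that by (intro order_trans[OF _ mult_left_mono[of 1 "norm (ln (real n))"]]) force+
    thus "\<forall>\<^sub>F n in sequentially. norm (real (nr + 4)) \<le> real (nr + 4) * norm (ln (real n))"
      unfolding eventually_sequentially by blast
  qed
next
  fix v assume v: "v \<in> rt_lang (the_oca d)"
  have sub: "{com (the_oca d) v i (length v) | i. i < length v - 1} \<subseteq> {..nr + 4}"
    using com_bound[OF v] by auto
  moreover from sub have "finite {com (the_oca d) v i (length v) | i. i < length v - 1}"
    by (rule finite_subset) simp
  ultimately have "mcom (the_oca d) v \<le> nr + 4" unfolding mcom_def by (subst Max_le_iff) auto
  thus "real (mcom (the_oca d) v) \<le> real (nr + 4)" by simp
qed

end

section \<open>Registers as prime exponents\<close>

definition code_nth :: "nat \<Rightarrow> nat \<Rightarrow> nat" where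
  "code_nth i l = code_fst (((\<lambda>l. code_snd (l - 1)) ^^ i) l - 1)"

lemma code_nth_encode: "i < length xs \<Longrightarrow> code_nth i (list_encode xs) = xs ! i"
proof -
  have "((\<lambda>l. code_snd (l - 1)) ^^ i) (list_encode xs) = list_encode (drop i xs)" if "i \<le> length xs"
    using that
  proof (induction i)
    case (Suc i)
    hence "drop i xs = xs ! i # drop (Suc i) xs" by (simp add: Cons_nth_drop_Suc)
    thus ?case using Suc by simp
  qed simp
  moreover assume "i < length xs"
  moreover from this have "drop i xs = xs ! i # drop (Suc i) xs" by (simp add: Cons_nth_drop_Suc)
  ultimately show ?thesis by (simp add: code_nth_def)
qed

lemma computable_code_nth: "computable k f \<Longrightarrow> computable k (\<lambda>xs. code_nth i (f xs))"
proof -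
  assume f: "computable k f"
  have "computable k (\<lambda>xs. ((\<lambda>l. code_snd (l - 1)) ^^ i) (f xs))"
  proof (induction i)
    case (Suc i)
    have "computable k (\<lambda>xs. code_snd (((\<lambda>l. code_snd (l - 1)) ^^ i) (f xs) - 1))"
      by (intro computable_code_snd computable_diff Suc computable_const)
    thus ?case by simp
  qed (use f in simp)
  thus ?thesis unfolding code_nth_def by (intro computable_code_fst computable_diff computable_const)
qed

text \<open>Everything in the code of an automaton except the length of the countdown is a number that depends
  on the program only; this function assembles the code from these numbers. Since it is the same
  function for all programs, a program can apply it to its own numbers.\<close>
definition assemble :: "nat \<Rightarrow> nat \<Rightarrow> nat" where
  "assemble A D =
    (let S = code_nth 0 A; d = code_nth 7 A * code_nth 8 A ^ D
     in code_cons (Suc (S + d)) (code_cons (code_nth 1 A) (code_cons (code_cons (code_nth 2 A) (code_cons (S + d) 0))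
       (code_cons (code_nth 3 A) (code_cons (code_rev_append (code_nth 4 A) (code_replicate 0 d))
       (code_cons (code_rev_append (code_nth 5 A) (code_countdown_rows (code_nth 6 A) (Suc S) d)) 0))))))"

lemma computable_assemble: "computable 1 (\<lambda>xs. assemble (xs ! 0) (xs ! 0))"
  unfolding assemble_def Let_def
  by (intro computable_code_cons computable_code_rev_append computable_code_replicate
      computable_code_countdown_rows computable_code_nth computable_const computable_proj computable_add
      computable_mult computable_power computable_Suc) auto

context ray_oca
begin

text \<open>The lists are stored reversed, as \<open>assemble\<close> prepends them by
  \<open>code_rev_append\<close>; \<open>c\<close> and \<open>p\<close> determine the countdown
  length \<open>c * p ^ D\<close>.\<close>

definition parts :: "nat \<Rightarrow> nat \<Rightarrow> nat" where
  "parts c p = list_encode [cell_count, list_encode [enc (Final True)], enc LetterA, message_count,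
     list_encode (rev (map emit_code [0..<Suc cell_count])), list_encode (rev fixed_rows),
     list_encode (rev chain_rest), c, p]"

lemma oca_code_the_oca: "oca_code (the_oca (c * p ^ D)) = assemble (parts c p) D"
proof -
  have e: "enc (Chain d) = cell_count + d" for d by (simp add: enc_def)
  have code_cons_0: "code_cons x 0 = list_encode [x]" for x by (simp add: code_cons_def)
  show ?thesis
    unfolding oca_code_def bl_tab_the_oca_append delta_tab_the_oca_append assemble_def Let_def parts_def
    by (simp add: code_nth_encode e code_replicate_encode code_countdown_rows_encode code_rev_append_encode
        code_cons_0 code_cons_encode numeral_eq_Suc
        del: upt_Suc list_encode.simps(2))
qed

end

section \<open>Commands as a finite control\<close>

fun cmd_regs :: "cmd \<Rightarrow> nat set" where
  "cmd_regs Skip = {}"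
| "cmd_regs (Inc i) = {i}"
| "cmd_regs (Seq a b) = cmd_regs a \<union> cmd_regs b"
| "cmd_regs (Loop i c) = insert i (cmd_regs c)"

lemma finite_cmd_regs: "finite (cmd_regs c)"
  by (induction c) auto

text \<open>The stacks met while \<open>c\<close> runs in front of \<open>k\<close>. There are
  finitely many, because a loop body always returns to the same stack \<open>Loop i c # k\<close>;
  hence a message can carry the whole stack as its control.\<close>

fun conts :: "cmd \<Rightarrow> cmd list \<Rightarrow> cmd list set" where
  "conts Skip k = {Skip # k}"
| "conts (Inc i) k = {Inc i # k}"
| "conts (Seq a b) k = {Seq a b # k} \<union> conts a (b # k) \<union> conts b k"
| "conts (Loop i c) k = {Loop i c # k} \<union> conts c (Loop i c # k)"

lemma finite_conts: "finite (conts c k)"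
  by (induction c arbitrary: k) auto

lemma Cons_in_conts: "c # k \<in> conts c k"
  by (cases c) auto

lemma fst_step_conts: "S \<in> conts c k \<Longrightarrow> fst (step (S, R)) \<in> insert k (conts c k)"
proof (induction c arbitrary: k)
  case (Seq a b)
  thus ?case using Cons_in_conts[of a "b # k"] Cons_in_conts[of b k] by fastforce
next
  case (Loop i c)
  thus ?case using Cons_in_conts[of c "Loop i c # k"] by (fastforce split: if_splits)
qed auto

text \<open>Ray 0 multiplies the position by the growth factor \<^term>\<open>K\<close>; the rays \<^term>\<open>2 + 2 * i\<close> and
  \<^term>\<open>3 + 2 * i\<close> in addition multiply and divide it by the prime of register \<^term>\<open>i\<close>. Ray 1 is the one on which
  marked columns emit.\<close>
fun stop_at :: "cmd list \<Rightarrow> nat set \<Rightarrow> cmd list option" where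
  "stop_at [] E = (if 0 \<in> E then Some [] else None)"
| "stop_at (Skip # k) E = (if 0 \<in> E then Some k else None)"
| "stop_at (Inc i # k) E = (if 2 + 2 * i \<in> E then Some k else None)"
| "stop_at (Seq a b # k) E = (if 0 \<in> E then Some (a # b # k) else None)"
| "stop_at (Loop i c # k) E = (if 3 + 2 * i \<in> E then Some (c # Loop i c # k) else if 0 \<in> E then Some k else None)"

lemma stop_at_step: "stop_at S E = Some S' \<Longrightarrow> \<exists>R. S' = fst (step (S, R))"
proof -
  assume s: "stop_at S E = Some S'"
  show ?thesis
  proof (cases S)
    case (Cons c k)
    thus ?thesis using s
      \<comment> \<open>Zero registers make a loop end, registers equal to 1 make it enter its
        body.\<close>
      by (cases c) (auto split: if_splits intro: exI[of _ "\<lambda>_. 0"] exI[of _ "\<lambda>_. 1"])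
  qed (use s in \<open>auto split: if_splits\<close>)
qed

definition nth_prime :: "nat \<Rightarrow> nat" where "nth_prime i = enumerate {p. prime p} i"

lemma prime_nth_prime: "prime (nth_prime i)"
  using enumerate_in_set[OF primes_infinite, of i] by (simp add: nth_prime_def)

lemma nth_prime_less_iff: "nth_prime i < nth_prime j \<longleftrightarrow> i < j"
  unfolding nth_prime_def using enumerate_mono_iff[OF primes_infinite] by blast

text \<open>The first leg comes from the countdown instead of a marked column. With a
  \<open>Seq\<close> in front, the step that belongs to it changes no register and ends on ray 0, as
  the initial row requires.\<close>

locale prime_machine =
  fixes nregs :: nat and c0 :: cmd and pol :: bool
  assumes regs_c0: "cmd_regs c0 \<subseteq> {..<nregs}" and nregs_pos: "0 < nregs"
    and c0_Seq: "\<exists>a b. c0 = Seq a b"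
begin

abbreviation K :: nat where "K \<equiv> nth_prime nregs"
definition primes_prod :: nat where "primes_prod = (\<Prod>i<nregs. nth_prime i)"

text \<open>The common factor \<open>primes_prod\<close> makes the slope obtained by division by a
  register prime an integer. Among the rays in use, ray 1 is the steepest, since \<open>K\<close>
  exceeds the register primes.\<close>

definition slope :: "nat \<Rightarrow> nat" where
  "slope j = (if j = 0 then primes_prod else if j = 1 then K * primes_prod
     else if even j then primes_prod div nth_prime (j div 2 - 1) else primes_prod * nth_prime (j div 2 - 1))"

definition nrays :: nat where "nrays = 2 + 2 * nregs"

definition reachable :: "cmd list set" where "reachable = insert [] (conts c0 [])"

definition val :: "(nat \<Rightarrow> nat) \<Rightarrow> nat" where "val R = (\<Prod>i<nregs. nth_prime i ^ R i)"

lemma prime_gt_1: "1 < nth_prime i"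
  using prime_gt_1_nat prime_nth_prime by blast

lemma prime_pos: "0 < nth_prime i"
  using prime_gt_0_nat prime_nth_prime by blast

lemma primes_prod_pos: "0 < primes_prod"
  by (simp add: primes_prod_def prime_pos prod_pos)

lemma val_pos: "0 < val R"
  by (simp add: val_def prime_pos prod_pos)

lemma val_Suc: "i < nregs \<Longrightarrow> val (R(i := Suc (R i))) = nth_prime i * val R"
proof -
  assume i: "i < nregs"
  have "(\<Prod>j\<in>{..<nregs} - {i}. nth_prime j ^ (R(i := Suc (R i))) j) = (\<Prod>j\<in>{..<nregs} - {i}. nth_prime j ^ R j)"
    by (intro prod.cong) auto
  thus ?thesis using i by (simp add: val_def prod.remove[of _ i])
qed

lemma dvd_val: "i < nregs \<Longrightarrow> nth_prime i dvd val R \<longleftrightarrow> R i \<noteq> 0"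
proof
  assume i: "i < nregs" and d: "nth_prime i dvd val R"
  then obtain j where j: "j < nregs" "nth_prime i dvd nth_prime j ^ R j"
    using prime_dvd_prod_iff[of "{..<nregs}" "nth_prime i"] prime_nth_prime by (auto simp: val_def)
  hence "nth_prime i dvd nth_prime j" using prime_dvd_power prime_nth_prime by blast
  hence "nth_prime i = nth_prime j" using primes_dvd_imp_eq prime_nth_prime by blast
  hence "i = j" using nth_prime_less_iff[of i j] nth_prime_less_iff[of j i] by simp
  thus "R i \<noteq> 0" using j(2) prime_gt_1[of i] by (intro notI) simp
next
  assume i: "i < nregs" and "R i \<noteq> 0"
  then obtain r where "R i = Suc r" by (cases "R i") auto
  hence "val R = nth_prime i * val (R(i := r))" using val_Suc[OF i, of "R(i := r)"] by (simp add: fun_upd_idem)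
  thus "nth_prime i dvd val R" by simp
qed

definition rays_at :: "nat \<Rightarrow> nat \<Rightarrow> nat set" where
  "rays_at x y = {j. j < nrays \<and> slope j * x = y}"

lemma ray_nop: "0 \<in> rays_at x (K * primes_prod * u) \<longleftrightarrow> x = K * u"
  using primes_prod_pos by (simp add: rays_at_def slope_def nrays_def mult.commute[of K] mult.assoc)

lemma ray_inc:
  assumes "i < nregs"
  shows "2 + 2 * i \<in> rays_at x (K * primes_prod * u) \<longleftrightarrow> x = K * nth_prime i * u"
proof -
  have "nth_prime i dvd primes_prod" using assms by (auto simp: primes_prod_def intro: dvd_prodI)
  then obtain q where q: "primes_prod = nth_prime i * q" by blast
  hence "0 < q" using primes_prod_pos by (cases q) auto
  moreover have "slope (2 + 2 * i) = q" using q prime_pos[of i] by (simp add: slope_def)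
  moreover have "q * x = K * (nth_prime i * q) * u \<longleftrightarrow> q * x = q * (K * nth_prime i * u)"
    by (simp add: ac_simps)
  ultimately show ?thesis using assms q by (simp add: rays_at_def nrays_def)
qed

lemma ray_dec:
  assumes "i < nregs"
  shows "3 + 2 * i \<in> rays_at x (K * primes_prod * u) \<longleftrightarrow> nth_prime i * x = K * u"
proof -
  have "slope (3 + 2 * i) = primes_prod * nth_prime i" by (simp add: slope_def)
  moreover have "primes_prod * nth_prime i * x = K * primes_prod * u \<longleftrightarrow>
     primes_prod * (nth_prime i * x) = primes_prod * (K * u)" by (simp add: ac_simps)
  ultimately show ?thesis using assms primes_prod_pos by (simp add: rays_at_def nrays_def)
qed

lemma step_regs:
  "\<forall>c\<in>set S. cmd_regs c \<subseteq> {..<nregs} \<Longrightarrow> \<forall>c\<in>set (fst (step (S, R))). cmd_regs c \<subseteq> {..<nregs}"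
  by (cases "(S, R)" rule: step.cases) simp_all

text \<open>In a \<open>Loop\<close> the message would meet the decrementing ray at
  \<open>K * u\<close> divided by the prime, short of the meeting with ray 0 at
  \<open>K * u\<close>. The former is a column exactly if the register is nonzero; otherwise the
  message goes on to ray 0 and leaves the loop.\<close>

lemma stop_at_simulates:
  fixes n :: nat
  assumes S: "\<forall>c\<in>set S. cmd_regs c \<subseteq> {..<nregs}" and st: "step (S, R) = (S', R')"
  defines "u \<equiv> K ^ n * val R" and "u' \<equiv> K ^ Suc n * val R'"
  shows "u < u' \<and> stop_at S (rays_at u' (K * primes_prod * u)) = Some S' \<and>
    (\<forall>x. u < x \<longrightarrow> x < u' \<longrightarrow> stop_at S (rays_at x (K * primes_prod * u)) = None)" (is ?goal)
proof -
  have u: "0 < u" using val_pos prime_pos by (simp add: u_def)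
  hence Ku: "u < K * u" using prime_gt_1[of nregs] by simp
  have nop: ?goal if "R' = R" "\<And>E. stop_at S E = (if 0 \<in> E then Some S' else None)"
  proof -
    have "u' = K * u" using that(1) by (simp add: u_def u'_def)
    thus ?goal using Ku that(2) by (simp add: ray_nop)
  qed
  show ?goal
  proof (cases "(S, R)" rule: step.cases)
    case (3 i k R0)
    hence i: "i < nregs" and R': "R' = R(i := Suc (R i))" "S' = k" using S st by auto
    have u': "u' = K * nth_prime i * u" using val_Suc[OF i, of R] R' by (simp add: u_def u'_def)
    have "u < u'" using Ku prime_pos[of i] unfolding u'
      by (metis mult.assoc mult.left_commute nat_mult_le_cancel_disj One_nat_def Suc_leI less_le_trans mult.right_neutral mult_le_mono2)
    thus ?goal using 3 R' u' by (auto simp: ray_inc[OF i, simplified])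
  next
    case (5 i c k R0)
    hence i: "i < nregs" using S by auto
    have pK: "nth_prime i < K" using i nth_prime_less_iff by simp
    have stop: "stop_at S E = (if 3 + 2 * i \<in> E then Some (c # Loop i c # k) else if 0 \<in> E then Some k else None)" for E
      using 5 by simp
    show ?goal
    proof (cases "R i = 0")
      case True
      hence "R' = R" "S' = k" using 5 st by auto
      hence u': "u' = K * u" by (simp add: u_def u'_def)
      \<comment> \<open>\<open>K\<close> is a different prime, so the accumulated growth cannot
        simulate a nonzero register.\<close>
      have "\<not> nth_prime i dvd K ^ Suc n * val R"
        using dvd_val[OF i, of R] True pK primes_dvd_imp_eq[OF prime_nth_prime prime_nth_prime, of i nregs]
          prime_dvd_power[OF prime_nth_prime, of i K "Suc n"] prime_dvd_mult_iff[OF prime_nth_prime, of i] by auto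
      hence "nth_prime i * x \<noteq> K * u" for x by (metis dvd_triv_left u_def power_Suc mult.assoc)
      thus ?goal using Ku \<open>S' = k\<close> unfolding stop u' by (simp add: ray_nop ray_dec[OF i, simplified])
    next
      case False
      then obtain r where r: "R i = Suc r" by (cases "R i") auto
      hence R': "R' = R(i := r)" "S' = c # Loop i c # k" using 5 st by auto
      have "val R = nth_prime i * val R'"
        using val_Suc[OF i, of R'] r R' by (simp add: fun_upd_idem)
      hence u': "nth_prime i * u' = K * u" by (simp add: u_def u'_def)
      have "u < u'"
      proof (rule ccontr)
        assume "\<not> u < u'"
        hence "nth_prime i * u' \<le> nth_prime i * u" by simp
        also have "\<dots> < K * u" using pK u by simp
        finally show False using u' by simp
      qed
      moreover have "nth_prime i * x \<noteq> K * u" "x \<noteq> K * u" if "x < u'" for x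
      proof -
        show "nth_prime i * x \<noteq> K * u" using u' that prime_pos[of i] by (metis mult_less_cancel2 mult.commute less_irrefl)
        have "x < nth_prime i * u'" using that prime_pos[of i] by (metis One_nat_def Suc_leI less_le_trans mult.left_neutral mult_le_mono1)
        thus "x \<noteq> K * u" using u' by simp
      qed
      ultimately show ?goal using R'(2) u' unfolding stop by (simp add: ray_nop ray_dec[OF i, simplified])
    qed
  next
    case (1 R0)
    show ?goal by (rule nop) (use 1 st in auto)
  next
    case (2 k R0)
    show ?goal by (rule nop) (use 2 st in auto)
  next
    case (4 a b k R0)
    show ?goal by (rule nop) (use 4 st in auto)
  qed
qed

definition config :: "nat \<Rightarrow> nat \<Rightarrow> config" where
  "config D n = (step ^^ n) ([c0], (\<lambda>_. 0)(0 := D))"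

definition start_length :: "nat \<Rightarrow> nat" where "start_length D = primes_prod * nth_prime 0 ^ D"

text \<open>The first leg performs a step without gaining a factor \<open>K\<close>: at stop
  \<open>n\<close> the machine has done \<open>Suc n\<close> steps, but only \<open>n\<close>
  factors have accumulated.\<close>

definition position :: "nat \<Rightarrow> nat \<Rightarrow> nat" where
  "position D n = K ^ n * val (snd (config D (Suc n)))"

definition launch :: "nat \<Rightarrow> nat \<Rightarrow> nat" where
  "launch D n = (case n of 0 \<Rightarrow> start_length D | Suc n \<Rightarrow> K * primes_prod * position D n)"

lemma config_Suc: "config D (Suc n) = step (config D n)"
  by (simp add: config_def)

lemma config_regs: "\<forall>c\<in>set (fst (config D n)). cmd_regs c \<subseteq> {..<nregs}"
proof (induction n)
  case (Suc n)
  show ?case unfolding config_Suc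
    using step_regs[OF Suc, of "snd (config D n)"] by simp
qed (use regs_c0 in \<open>simp add: config_def\<close>)

lemma start_length_position: "start_length D = primes_prod * position D 0"
proof -
  have "val ((\<lambda>_. 0)(0 := D)) = nth_prime 0 ^ D"
    using nregs_pos by (simp add: val_def prod.remove[of "{..<nregs}" 0])
  moreover have "snd (config D (Suc 0)) = (\<lambda>_. 0)(0 := D)" using c0_Seq by (auto simp: config_def)
  ultimately show ?thesis by (simp add: start_length_def position_def)
qed

lemma oca: "ray_oca nrays 1 stop_at reachable [c0]"
proof
  show "stop_at q E = Some q' \<Longrightarrow> q' \<in> reachable" if "q \<in> reachable" for q E q'
    using that stop_at_step[of q E q'] fst_step_conts[of q c0 "[]"] by (auto simp: reachable_def split: if_splits)
qed (auto simp: reachable_def finite_conts Cons_in_conts nrays_def)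

lemma orbit: "ray_orbit nrays slope 1 stop_at reachable [c0] (start_length D) (\<lambda>n. fst (config D n)) (launch D) (position D)"
proof -
  have sim: "position D n < position D (Suc n) \<and>
      stop_at (fst (config D (Suc n))) (rays_at (position D (Suc n)) (K * primes_prod * position D n)) = Some (fst (config D (Suc (Suc n)))) \<and>
      (\<forall>x. position D n < x \<longrightarrow> x < position D (Suc n) \<longrightarrow>
        stop_at (fst (config D (Suc n))) (rays_at x (K * primes_prod * position D n)) = None)" for n
    unfolding position_def
    by (rule stop_at_simulates[OF config_regs]) (simp add: config_Suc[of D "Suc n"])
  obtain a b where ab: "c0 = Seq a b" using c0_Seq by blast
  have first: "stop_at [c0] (rays_at x (start_length D)) = (if x = position D 0 then Some [a, b] else None)" for x
    using ab primes_prod_pos by (auto simp: rays_at_def slope_def nrays_def start_length_position)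
  have cfg0: "fst (config D 0) = [c0]" "fst (config D (Suc 0)) = [a, b]" unfolding config_def by (simp_all add: ab)
  have pos: "0 < position D n" for n by (simp add: position_def prime_pos val_pos)
  have s1: "slope 1 = K * primes_prod" by (simp add: slope_def)
  show ?thesis
  proof (intro ray_orbit.intro oca ray_orbit_axioms.intro)
    show "0 < start_length D" by (simp add: start_length_def primes_prod_pos prime_pos)
    show "launch D n < slope 1 * position D n" for n
    proof (cases n)
      case 0
      thus ?thesis unfolding s1 using pos prime_gt_1[of nregs] primes_prod_pos
        by (simp add: launch_def start_length_position)
    next
      case (Suc k)
      thus ?thesis unfolding s1 using sim[of k] prime_pos primes_prod_pos by (simp add: launch_def)
    qed
    show "stop_at (fst (config D n)) {j. j < nrays \<and> slope j * u = launch D n} = None"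
      if "n = 0 \<or> position D (n - 1) < u" "u < position D n" for n u
      using that sim[of "n - 1"] first[of u] cfg0 by (cases n) (auto simp: launch_def rays_at_def)
    show "stop_at (fst (config D n)) {j. j < nrays \<and> slope j * position D n = launch D n} = Some (fst (config D (Suc n)))" for n
      using sim[of "n - 1"] first[of "position D 0"] cfg0 by (cases n) (auto simp: launch_def rays_at_def)
    show "launch D (Suc n) = slope 1 * position D n" for n
      unfolding s1 by (simp add: launch_def)
  qed (use sim pos cfg0 in \<open>auto simp: launch_def\<close>)
qed

end

section \<open>Diagonalization\<close>

context prime_machine
begin

text \<open>The right-hand side of the assumption does not mention \<open>D\<close>, so it can be
  met by definition. Then \<open>D\<close> describes the program part and is also the initial
  register content, whence the diagonal \<open>assemble D D\<close>.\<close>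

lemma language:
  assumes "D = ray_oca.parts nrays slope 1 stop_at reachable [c0] {[]} pol primes_prod (nth_prime 0)"
  obtains M a b where "oca_wf M" "SC_OCA_n M" "MC_OCA_log M" "inp_list M = [a, b]" "a \<noteq> b"
    "oca_code M = assemble D D"
    "rt_lang M = {replicate m a @ replicate n b | m n. 0 < m + n \<and>
       (\<exists>k. m = Suc (position D k) \<and> launch D k < n \<and> fst (config D (Suc k)) = []) = pol}"
proof -
  interpret ray_orbit nrays slope 1 stop_at reachable "[c0]" "{[]}" pol "start_length D"
    "\<lambda>n. fst (config D n)" "launch D" "position D"
    by (rule orbit)
  show thesis
  proof (rule that)
    show "oca_wf (the_oca (start_length D))" by (rule oca_wf_the_oca)
    show "SC_OCA_n (the_oca (start_length D))" by (rule SC_the_oca)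
    show "MC_OCA_log (the_oca (start_length D))" by (rule MC_the_oca)
    show "inp_list (the_oca (start_length D)) = [enc LetterA, enc (Chain (start_length D))]"
      by (rule the_oca_sel)
    show "enc LetterA \<noteq> enc (Chain (start_length D))" by (rule letters_neq)
    show "oca_code (the_oca (start_length D)) = assemble D D"
      using oca_code_the_oca[of primes_prod "nth_prime 0" D] assms by (simp add: start_length_def)
  qed (unfold rt_lang_the_oca_words hits_def, simp)
qed

lemma position_gap: "position D n < position D (Suc n)" "n < position D n"
proof -
  interpret ray_orbit nrays slope 1 stop_at reachable "[c0]" "{[]}" pol "start_length D"
    "\<lambda>n. fst (config D n)" "launch D" "position D"
    by (rule orbit)
  show "position D n < position D (Suc n)" by (rule us_Suc)
  show "n < position D n" using us_pos us_Suc by (induction n) (auto intro: Suc_lessI less_trans_Suc le_less_trans)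
qed

lemma config_halted:
  assumes "fst (config D n) = []" "n \<le> n'"
  shows "config D n' = config D n"
  using assms(2)
proof (induction n' rule: dec_induct)
  case (step n')
  thus ?case using assms(1) by (cases "config D n") (simp add: config_Suc)
qed simp

lemma halting_gaps:
  assumes "fst (config D N) = []"
  shows "\<exists>m n. p \<le> m \<and> (\<exists>k. m = Suc (position D k) \<and> launch D k < n \<and> fst (config D (Suc k)) = []) \<and>
    (\<forall>m' n'. m < m' \<longrightarrow> m' \<le> m + p \<longrightarrow> \<not> (\<exists>k. m' = Suc (position D k) \<and> launch D k < n' \<and> fst (config D (Suc k)) = []))"
proof -
  \<comment> \<open>After \<open>N\<close> steps the registers are frozen and each stop multiplies
    the position by \<open>K\<close>; \<open>p\<close> more stops bring it above \<open>p\<close>,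
    so the next doubling jumps over a gap of length \<open>p\<close>.\<close>
  define k where "k = N + p"
  have h: "fst (config D (Suc k)) = []" "position D (Suc k) = K * position D k"
    using assms config_halted[OF assms, of "Suc k"] config_halted[OF assms, of "Suc (Suc k)"]
    by (simp_all add: k_def position_def)
  have "2 * position D k \<le> position D (Suc k)" using h(2) prime_gt_1[of nregs] by simp
  moreover have p: "p < position D k" using position_gap(2)[of k D] by (simp add: k_def)
  ultimately have gap: "position D k + p < position D (Suc k)" by simp
  have mono: "strict_mono (position D)" using position_gap(1) by (simp add: strict_mono_Suc_iff)
  have "m' \<noteq> Suc (position D j)" if "Suc (position D k) < m'" "m' \<le> Suc (position D k) + p" for m' j
  proof
    assume m': "m' = Suc (position D j)"
    hence "position D k < position D j" "position D j < position D (Suc k)" using that gap by auto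
    thus False using strict_mono_less[OF mono] by (metis not_less_eq)
  qed
  thus ?thesis using h(1) p by (intro exI[of _ "Suc (position D k)"] exI[of _ "Suc (launch D k)"]) auto
qed

end

lemma regs_bound: obtains k where "0 < k" "cmd_regs c \<subseteq> {..<k}"
proof -
  obtain k where "cmd_regs c \<subseteq> {..<k}" using finite_cmd_regs finite_nat_iff_bounded by blast
  hence "cmd_regs c \<subseteq> {..<Suc k}" by auto
  thus thesis by (rule that[rotated]) simp
qed

text \<open>The program of the automaton computes \<^term>\<open>r\<close> on the code of the automaton; it halts on result 0 and
  diverges on any other result.\<close>
theorem diagonal_oca:
  obtains M a b H where "oca_wf M" "SC_OCA_n M" "MC_OCA_log M" "inp_list M = [a, b]" "a \<noteq> b"
    "rt_lang M = {replicate m a @ replicate n b | m n. 0 < m + n \<and> H m n = pol}"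
    "\<And>p. rec_eval r [oca_code M] 0 \<Longrightarrow> \<exists>m n. p \<le> m \<and> H m n \<and> (\<forall>m' n'. m < m' \<longrightarrow> m' \<le> m + p \<longrightarrow> \<not> H m' n')"
    "\<And>v m n. rec_eval r [oca_code M] (Suc v) \<Longrightarrow> \<not> H m n"
proof -
  obtain ra where ra: "\<And>xs. length xs = 1 \<Longrightarrow> rec_eval ra xs (assemble (xs ! 0) (xs ! 0))"
    using computable_assemble by (auto simp: computable_def)
  obtain c where c: "implements (Cn r [ra]) 1 c 0 1 2"
    using recf_compile[of 0 1 2 1 "Cn r [ra]"] by auto
  \<comment> \<open>Register 1 holds the result of \<open>c\<close>. On 0 the loop is left at once;
    otherwise each round takes 1 away and puts it back, forever.\<close>
  define c0 where "c0 = Seq c (Loop 1 (Inc 1))"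
  obtain k where k: "0 < k" "cmd_regs c0 \<subseteq> {..<k}" by (rule regs_bound)
  interpret prime_machine k c0 pol by unfold_locales (use k c0_def in auto)
  define D where "D = ray_oca.parts nrays slope 1 stop_at reachable [c0] {[]} pol primes_prod (nth_prime 0)"
  let ?H = "\<lambda>m n. \<exists>k. m = Suc (position D k) \<and> launch D k < n \<and> fst (config D (Suc k)) = []"
  let ?R = "(\<lambda>_. 0)(0 := D)"
  obtain M a b where M: "oca_wf M" "SC_OCA_n M" "MC_OCA_log M" "inp_list M = [a, b]" "a \<noteq> b"
    "oca_code M = assemble D D" "rt_lang M = {replicate m a @ replicate n b | m n. 0 < m + n \<and> ?H m n = pol}"
    by (rule language[OF D_def])
  have run: "\<exists>n. config D n = ([Loop 1 (Inc 1)], ?R(1 := v))" if "rec_eval r [oca_code M] v" for v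
  proof -
    have "rec_eval (Cn r [ra]) [D] v"
      by (rule rec_eval.comp[of _ "[assemble D D]"]) (use that M(6) ra[of "[D]"] in auto)
    hence "runs c ?R (?R(1 := v))" by (intro implementsD[OF c]) auto
    then obtain n where "(step ^^ n) (c # [Loop 1 (Inc 1)], ?R) = ([Loop 1 (Inc 1)], ?R(1 := v))"
      unfolding runs_def by blast
    hence "config D (Suc n) = ([Loop 1 (Inc 1)], ?R(1 := v))"
      unfolding config_def by (simp only: c0_def funpow_Suc_right comp_apply step.simps)
    thus ?thesis by blast
  qed
  show thesis
  proof (rule that[OF M(1-5,7)])
    fix p assume "rec_eval r [oca_code M] 0"
    then obtain n where "config D n = ([Loop 1 (Inc 1)], ?R(1 := 0))" using run by blast
    hence "fst (config D (Suc n)) = []" by (simp add: config_Suc)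
    thus "\<exists>m n. p \<le> m \<and> ?H m n \<and> (\<forall>m' n'. m < m' \<longrightarrow> m' \<le> m + p \<longrightarrow> \<not> ?H m' n')"
      by (rule halting_gaps)
  next
    fix v m n assume "rec_eval r [oca_code M] (Suc v)"
    then obtain n0 where n0: "config D n0 = ([Loop 1 (Inc 1)], ?R(1 := Suc v))" using run by blast
    have loop: "\<exists>S R. config D (n0 + i) = (S, R) \<and> (S = [Loop 1 (Inc 1)] \<and> R 1 \<noteq> 0 \<or> S = [Inc 1, Loop 1 (Inc 1)])" for i
    proof (induction i)
      case (Suc i)
      thus ?case by (auto simp: config_Suc)
    qed (use n0 in auto)
    have "fst (config D i) \<noteq> []" for i
    proof
      assume "fst (config D i) = []"
      hence "fst (config D (n0 + i)) = []" using config_halted[of D i "n0 + i"] by simp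
      thus False using loop[of i] by auto
    qed
    thus "\<not> ?H m n" by blast
  qed
qed

section \<open>Undecidability and reductions\<close>

lemma undecidable_onI:
  assumes "\<And>r. \<exists>x\<in>D. (rec_eval r [code x] 0 \<longrightarrow> P x) \<and> (rec_eval r [code x] 1 \<longrightarrow> \<not> P x)"
  shows "undecidable_on D P code"
  unfolding undecidable_on_def
proof
  assume "\<exists>r. \<forall>x\<in>D. rec_eval r [code x] (if P x then 1 else 0)"
  then obtain r where r: "\<And>x. x \<in> D \<Longrightarrow> rec_eval r [code x] (if P x then 1 else 0)" by blast
  obtain x where "x \<in> D" "rec_eval r [code x] 0 \<longrightarrow> P x" "rec_eval r [code x] 1 \<longrightarrow> \<not> P x" using assms by blast
  thus False using r[of x] by (cases "P x") auto
qed

lemma undecidable_on_not: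
  assumes "undecidable_on D P code"
  shows "undecidable_on D (\<lambda>x. \<not> P x) code"
  unfolding undecidable_on_def
proof
  assume "\<exists>r. \<forall>x\<in>D. rec_eval r [code x] (if \<not> P x then 1 else 0)"
  then obtain r where r: "\<And>x. x \<in> D \<Longrightarrow> rec_eval r [code x] (if \<not> P x then 1 else 0)" by blast
  have "computable 1 (\<lambda>xs. 1 - xs ! 0)"
    by (intro computable_diff computable_const computable_proj) simp
  then obtain f where f: "\<And>xs. length xs = 1 \<Longrightarrow> rec_eval f xs (1 - xs ! 0)" by (auto simp: computable_def)
  have "rec_eval (Cn f [r]) [code x] (if P x then 1 else 0)" if "x \<in> D" for x
    by (rule rec_eval.comp[of _ "[if \<not> P x then 1 else 0]"])
      (use r[OF that] f[of "[if \<not> P x then 1 else 0]"] in auto)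
  thus False using assms unfolding undecidable_on_def by blast
qed

lemma undecidable_on_reduce:
  assumes "undecidable_on D P code" "computable 1 (\<lambda>xs. g (xs ! 0))"
    and "\<And>x. x \<in> D \<Longrightarrow> f x \<in> D' \<and> code' (f x) = g (code x) \<and> Q (f x) = P x"
  shows "undecidable_on D' Q code'"
  unfolding undecidable_on_def
proof
  assume "\<exists>r. \<forall>x\<in>D'. rec_eval r [code' x] (if Q x then 1 else 0)"
  then obtain r where r: "\<And>x. x \<in> D' \<Longrightarrow> rec_eval r [code' x] (if Q x then 1 else 0)" by blast
  obtain rg where rg: "\<And>xs. length xs = 1 \<Longrightarrow> rec_eval rg xs (g (xs ! 0))" using assms(2) by (auto simp: computable_def)
  have "rec_eval (Cn r [rg]) [code x] (if P x then 1 else 0)" if "x \<in> D" for x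
    by (rule rec_eval.comp[of _ "[g (code x)]"])
      (use r[of "f x"] assms(3)[OF that] rg[of "[code x]"] in auto)
  thus False using assms(1) unfolding undecidable_on_def by blast
qed

lemma two_blocks_eq_iff:
  assumes "a \<noteq> b"
  shows "replicate m a @ replicate n b = replicate m' a @ replicate n' b \<longleftrightarrow> m = m' \<and> n = n'" (is "?v = ?w \<longleftrightarrow> _")
proof
  have cnt: "count_list (replicate i c) c' = (if c = c' then i else 0)" for i and c c' :: 'a
    by (induction i) auto
  assume "?v = ?w"
  hence "count_list ?v a = count_list ?w a" "count_list ?v b = count_list ?w b" by simp_all
  thus "m = m' \<and> n = n'" using assms by (simp add: cnt)
qed simp

definition empty_oca :: oca where "empty_oca = OCA 1 [] [0] 0 [0] [0, 0]"

lemma empty_oca: "oca_wf empty_oca" "rt_lang empty_oca = {}"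
  by (auto simp: empty_oca_def oca_wf_def rt_lang_def)

text \<open>Both classes are treated at once: \<open>C\<close> has to contain only bounded automata
  that obey both communication bounds, and the diagonal automata do.\<close>

lemma all_problems_undecidable_superclass:
  assumes M: "\<And>M. oca_wf M \<Longrightarrow> SC_OCA_n M \<Longrightarrow> MC_OCA_log M \<Longrightarrow> bounded_lang (inp_list M) (rt_lang M) \<Longrightarrow> M \<in> C"
    and E: "empty_oca \<in> C"
  shows "all_problems_undecidable C"
proof -
  have diag: "\<exists>M\<in>C. \<exists>a b H. inp_list M = [a, b] \<and> a \<noteq> b \<and>
    rt_lang M = {replicate m a @ replicate n b | m n. 0 < m + n \<and> H m n = pol} \<and>
    (rec_eval r [oca_code M] 0 \<longrightarrow> (\<forall>p. \<exists>m n. p \<le> m \<and> H m n \<and> (\<forall>m' n'. m < m' \<longrightarrow> m' \<le> m + p \<longrightarrow> \<not> H m' n'))) \<and>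
    (rec_eval r [oca_code M] 1 \<longrightarrow> (\<forall>m n. \<not> H m n))" for r pol
  proof (rule diagonal_oca[where r = r and pol = pol])
    fix M a b H
    assume m: "oca_wf M" "SC_OCA_n M" "MC_OCA_log M" "inp_list M = [a, b]" "a \<noteq> b"
      "rt_lang M = {replicate m a @ replicate n b | m n. 0 < m + n \<and> H m n = pol}"
      "\<And>p. rec_eval r [oca_code M] 0 \<Longrightarrow> \<exists>m n. p \<le> m \<and> H m n \<and> (\<forall>m' n'. m < m' \<longrightarrow> m' \<le> m + p \<longrightarrow> \<not> H m' n')"
      "\<And>v m n. rec_eval r [oca_code M] (Suc v) \<Longrightarrow> \<not> H m n"
    have M_C: "M \<in> C" by (rule M) (use m(1-6) in \<open>auto simp: bounded_lang_def bstar_two\<close>)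
    have rej: "\<not> H m n" if "rec_eval r [oca_code M] 1" for m n using m(8)[of 0] that by simp
    show ?thesis
      by (intro bexI[of _ M] exI[of _ a] exI[of _ b] exI[of _ H] conjI impI allI m(4-7) M_C rej)
  qed
  \<comment> \<open>The common scheme for properties that languages with gaps have and the empty
    language lacks: answer 0 produces gaps and answer 1 emptiness.\<close>
  have positive: "undecidable_on C P oca_code"
    if inf: "\<And>M a b. M \<in> C \<Longrightarrow> rt_lang M \<subseteq> bstar [a, b] \<Longrightarrow> a \<noteq> b \<Longrightarrow>
       (\<And>p. \<exists>m n. p \<le> m \<and> replicate m a @ replicate n b \<in> rt_lang M \<and>
       (\<forall>m' n'. m < m' \<longrightarrow> m' \<le> m + p \<longrightarrow> replicate m' a @ replicate n' b \<notin> rt_lang M)) \<Longrightarrow> P M"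
      and emp: "\<And>M. rt_lang M = {} \<Longrightarrow> \<not> P M" for P
  proof (rule undecidable_onI)
    fix r
    obtain M a b H where M: "M \<in> C" "a \<noteq> b"
      "rt_lang M = {replicate m a @ replicate n b | m n. 0 < m + n \<and> H m n = True}"
      "rec_eval r [oca_code M] 0 \<longrightarrow> (\<forall>p. \<exists>m n. p \<le> m \<and> H m n \<and> (\<forall>m' n'. m < m' \<longrightarrow> m' \<le> m + p \<longrightarrow> \<not> H m' n'))"
      "rec_eval r [oca_code M] 1 \<longrightarrow> (\<forall>m n. \<not> H m n)" using diag[of True r] by blast
    have in_lang: "replicate m a @ replicate n b \<in> rt_lang M \<longleftrightarrow> 0 < m + n \<and> H m n" for m n
      unfolding M(3) by (simp add: two_blocks_eq_iff[OF M(2)])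
    have "P M" if acc: "rec_eval r [oca_code M] 0"
    proof (rule inf[OF M(1) _ M(2)])
      show "rt_lang M \<subseteq> bstar [a, b]" unfolding M(3) bstar_two by blast
      fix p
      \<comment> \<open>\<open>Suc p\<close> instead of \<open>p\<close> ensures
        \<open>0 < m\<close>: the empty word is never in the language.\<close>
      obtain m n where "Suc p \<le> m" "H m n" "\<forall>m' n'. m < m' \<longrightarrow> m' \<le> m + Suc p \<longrightarrow> \<not> H m' n'"
        using M(4) acc by blast
      thus "\<exists>m n. p \<le> m \<and> replicate m a @ replicate n b \<in> rt_lang M \<and>
       (\<forall>m' n'. m < m' \<longrightarrow> m' \<le> m + p \<longrightarrow> replicate m' a @ replicate n' b \<notin> rt_lang M)"
        unfolding in_lang by (intro exI[of _ m] exI[of _ n]) auto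
    qed
    moreover have "\<not> P M" if "rec_eval r [oca_code M] 1"
      using emp M(3,5) that by blast
    ultimately show "\<exists>M\<in>C. (rec_eval r [oca_code M] 0 \<longrightarrow> P M) \<and> (rec_eval r [oca_code M] 1 \<longrightarrow> \<not> P M)"
      using M(1) by blast
  qed
  have infinite: "undecidable_on C (\<lambda>M. infinite (rt_lang M)) oca_code"
  proof (rule positive)
    fix M :: oca and a b :: nat
    assume gaps: "\<And>p. \<exists>m n. p \<le> m \<and> replicate m a @ replicate n b \<in> rt_lang M \<and>
       (\<forall>m' n'. m < m' \<longrightarrow> m' \<le> m + p \<longrightarrow> replicate m' a @ replicate n' b \<notin> rt_lang M)"
    show "infinite (rt_lang M)"
    proof
      assume "finite (rt_lang M)"
      then obtain N where N: "\<And>w. w \<in> rt_lang M \<Longrightarrow> length w < N"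
        using finite_nat_iff_bounded[of "length ` rt_lang M"] by auto
      obtain m n where "N \<le> m" "replicate m a @ replicate n b \<in> rt_lang M" using gaps by blast
      thus False using N by fastforce
    qed
  qed auto
  have nonempty: "undecidable_on C (\<lambda>M. rt_lang M \<noteq> {}) oca_code"
    by (rule positive) auto
  have empty: "undecidable_on C (\<lambda>M. rt_lang M = {}) oca_code"
    using undecidable_on_not[OF nonempty] by simp
  have "regular_lang {}"
    unfolding regular_lang_def
    by (intro exI[of _ "{}"] exI[of _ "{0}"] exI[of _ 0] exI[of _ "\<lambda>_ _. 0"]) auto
  hence nonregular: "undecidable_on C (\<lambda>M. \<not> regular_lang (rt_lang M)) oca_code"
    by (intro positive not_regular_gaps) auto
  have "context_free_lang {}"
    unfolding context_free_lang_def
  proof (intro exI conjI)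
    \<comment> \<open>Without productions no parse tree has a nonterminal at its root.\<close>
    have "w \<notin> cfg_lang {} 0" for w
      using parse_tree.elims(2) by (auto simp: cfg_lang_parse_tree elim!: parse_tree.elims(2))
    thus "{} = cfg_lang {} 0" by blast
  qed simp
  hence noncf: "undecidable_on C (\<lambda>M. \<not> context_free_lang (rt_lang M)) oca_code"
    by (intro positive not_context_free_gaps) auto
  have universal: "undecidable_on C (\<lambda>M. rt_lang M \<noteq> bstar (inp_list M) - {[]}) oca_code"
  proof (rule undecidable_onI)
    fix r
    obtain M a b H where M: "M \<in> C" "inp_list M = [a, b]" "a \<noteq> b"
      "rt_lang M = {replicate m a @ replicate n b | m n. 0 < m + n \<and> H m n = False}"
      "rec_eval r [oca_code M] 0 \<longrightarrow> (\<forall>p. \<exists>m n. p \<le> m \<and> H m n \<and> (\<forall>m' n'. m < m' \<longrightarrow> m' \<le> m + p \<longrightarrow> \<not> H m' n'))"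
      "rec_eval r [oca_code M] 1 \<longrightarrow> (\<forall>m n. \<not> H m n)" using diag[of False r] by blast
    have "rt_lang M \<noteq> bstar (inp_list M) - {[]}" if acc: "rec_eval r [oca_code M] 0"
    proof -
      obtain m n where "Suc 0 \<le> m" "H m n" using M(5) acc by blast
      hence "replicate m a @ replicate n b \<in> bstar [a, b] - {[]}" "replicate m a @ replicate n b \<notin> rt_lang M"
        unfolding M(4) bstar_two by (auto simp: two_blocks_eq_iff[OF M(3)])
      thus ?thesis unfolding M(2) by blast
    qed
    moreover have "rt_lang M = bstar (inp_list M) - {[]}" if "rec_eval r [oca_code M] 1"
      using M(6) that unfolding M(2,4) bstar_two by auto
    ultimately show "\<exists>M\<in>C. (rec_eval r [oca_code M] 0 \<longrightarrow> rt_lang M \<noteq> bstar (inp_list M) - {[]}) \<and>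
        (rec_eval r [oca_code M] 1 \<longrightarrow> \<not> rt_lang M \<noteq> bstar (inp_list M) - {[]})"
      using M(1) by blast
  qed
  \<comment> \<open>Being included in, or equal to, the language of \<open>empty_oca\<close> means
    being empty.\<close>
  have pair: "undecidable_on (C \<times> C) Q pair_code"
    if "\<And>M. Q (M, empty_oca) \<longleftrightarrow> rt_lang M = {}" for Q
  proof (rule undecidable_on_reduce[OF empty])
    show "computable 1 (\<lambda>xs. prod_encode (xs ! 0, oca_code empty_oca))"
      by (intro computable_prod_encode computable_proj computable_const) simp
    show "(M, empty_oca) \<in> C \<times> C \<and> pair_code (M, empty_oca) = prod_encode (oca_code M, oca_code empty_oca) \<and>
      Q (M, empty_oca) = (rt_lang M = {})" if "M \<in> C" for M
      using that E \<open>\<And>M. Q (M, empty_oca) \<longleftrightarrow> rt_lang M = {}\<close> by (simp add: pair_code_def)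
  qed
  show ?thesis
    unfolding all_problems_undecidable_def
    using undecidable_on_not[OF infinite] infinite undecidable_on_not[OF universal]
      undecidable_on_not[OF nonregular] undecidable_on_not[OF noncf]
      pair[of "\<lambda>(M1, M2). rt_lang M1 \<subseteq> rt_lang M2"] pair[of "\<lambda>(M1, M2). rt_lang M1 = rt_lang M2"]
    by (simp add: empty_oca(2))
qed

theorem theorem2:
  shows "all_problems_undecidable RT_SC_bounded \<and> all_problems_undecidable RT_MC_bounded"
proof -
  have "SC_OCA_n empty_oca" "MC_OCA_log empty_oca"
    by (auto simp: SC_OCA_n_def MC_OCA_log_def empty_oca(2) intro!: exI[of _ "\<lambda>_. 0"])
  hence "empty_oca \<in> RT_SC_bounded" "empty_oca \<in> RT_MC_bounded"
    by (auto simp: RT_SC_bounded_def RT_MC_bounded_def empty_oca bounded_lang_def)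
  thus ?thesis
    by (auto intro!: all_problems_undecidable_superclass simp: RT_SC_bounded_def RT_MC_bounded_def)
qed

end
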